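(* There is a numerical (absolute) constant $c>0$ such that, whenever $0<\eta<1$, $0<\gamma<1$, and $N$ is a positive integer, one has $$(c\gamma)^N(1-\eta)\le\varepsilon^*(N,\eta,\gamma)\le(1-\eta^2)^{1/2}.$$
   Context: $\mathbb T=\{\zeta\in\mathbb C:|\zeta|=1\}$ is the unit circle and $m$ is its (normalized) Haar measure. $L^\infty=L^\infty(\mathbb T,m)$ is the space of essentially bounded complex-valued functions on $\mathbb T$ with the essential supremum norm $\|\cdot\|_\infty$. $H^\infty$ is the subspace of those $f\in L^\infty$ that agree a.e. on $\mathbb T$ with the (nontangential) boundary values of a bounded holomorphic function on the disk $\mathbb D=\{z\in\mathbb C:|z|<1\}$; equivalently, $\widehat f(k):=\int_{\mathbb T}\overline{\zeta}^{\,k}f(\zeta)\,dm(\zeta)=0$ for $k=-1,-2,\dots$. The dual space of $H^\infty$ (bounded linear functionals) is denoted $(H^\infty)^*$. For a nonempty set $\Phi\subset(H^\infty)^*$, put $$H^\infty_\Phi:=\{f\in H^\infty:\ \varphi(f)=0\ \text{for all }\varphi\in\Phi\},$$ equipped with the norm $\|\cdot\|_\infty$. Admissibility: for a Banach space $\mathcal X=(\mathcal X,\|\cdot\|)$, a point $x\in\mathcal X$ with $\|x\|\le1$, and a number $\varepsilon>0$, one says that $\varepsilon$ is $\mathcal X$-admissible for $x$ if there is a $\delta>0$ such that every $y\in\mathcal X$ with $\max\{\|x+y\|,\|x-y\|\}<1+\delta$ satisfies $\|y\|<\varepsilon$. For a finite set $\Phi\subset(H^\infty)^*$ and $f\in H^\infty_\Phi$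 with $\|f\|_\infty=1$, put $$\varepsilon_\Phi(f):=\inf\{\varepsilon>0:\ \varepsilon\text{ is }H^\infty_\Phi\text{-admissible for }f\}.$$ For a unit-norm $f\in H^\infty$ and $\eta\in(0,1)$, let $E_\eta(f):=\{\zeta\in\mathbb T:\ |f(\zeta)|\le\eta\}$ (defined up to a set of measure $0$). For a finite set $\Phi\subset(H^\infty)^*$ and $\eta,\gamma\in(0,1)$, let $$\mathcal M(\Phi,\eta,\gamma):=\{f\in H^\infty_\Phi:\ \|f\|_\infty=1,\ m(E_\eta(f))\ge\gamma\}.$$ Finally, for a positive integer $N$ and $\eta,\gamma\in(0,1)$, define $$\varepsilon^*(N,\eta,\gamma):=\inf_{\#\Phi=N}\ \inf\{\varepsilon_\Phi(f):\ f\in\mathcal M(\Phi,\eta,\gamma)\},$$ where the outer infimum is taken over all sets $\Phi\subset(H^\infty)^*$ of cardinality $N$. *)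

theory Defs
  imports "HOL-Probability.Probability"
begin

section \<open>Normalized Haar measure on the unit circle\<close>

abbreviation unit_circle :: "complex set" where
  "unit_circle \<equiv> sphere 0 1"

text \<open>The push-forward under \<^const>\<open>cis\<close> of normalized Lebesgue measure on \<open>[0, 2\<pi>]\<close>;
  its \<open>\<sigma>\<close>-algebra is the Borel one.\<close>

definition circle_measure :: "complex measure" where
  "circle_measure =
     distr (uniform_measure lborel {0..2*pi}) (restrict_space borel unit_circle) cis"

lemma space_circle_measure [simp]: "space circle_measure = unit_circle"
  and sets_circle_measure [measurable_cong]:
    "sets circle_measure = sets (restrict_space borel unit_circle)"
  by (simp_all add: circle_measure_def space_restrict_space)

interpretation circle_measure: prob_space circle_measure
proof -
  interpret U: prob_space "uniform_measure lborel {0..2*pi}"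
    by (rule prob_space_uniform_measure) auto
  have "continuous_on UNIV cis"
    by (simp add: continuous_on_cis)
  then have "cis \<in> borel_measurable borel"
    by (rule borel_measurable_continuous_onI)
  then show "prob_space circle_measure"
    unfolding circle_measure_def by (intro U.prob_space_distr measurable_restrict_space2) auto
qed


section \<open>The space \<open>L\<^sup>\<infinity>\<close> of the circle\<close>

definition ess_bounded :: "(complex \<Rightarrow> complex) \<Rightarrow> bool" where
  "ess_bounded f \<longleftrightarrow> f \<in> borel_measurable circle_measure
     \<and> esssup circle_measure (\<lambda>\<zeta>. ereal (cmod (f \<zeta>))) < \<infinity>"

definition ae_eq :: "(complex \<Rightarrow> complex) \<Rightarrow> (complex \<Rightarrow> complex) \<Rightarrow> bool" where
  "ae_eq f g \<longleftrightarrow> ess_bounded f \<and> ess_bounded g \<and> (AE \<zeta> in circle_measure. f \<zeta> = g \<zeta>)"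

definition ess_norm :: "(complex \<Rightarrow> complex) \<Rightarrow> real" where
  "ess_norm f = real_of_ereal (esssup circle_measure (\<lambda>\<zeta>. ereal (cmod (f \<zeta>))))"

lemma ess_bounded_measurable [measurable_dest]:
  "ess_bounded f \<Longrightarrow> f \<in> borel_measurable circle_measure"
  by (simp add: ess_bounded_def)

lemma esssup_cmod_nonneg:
  "0 \<le> esssup circle_measure (\<lambda>\<zeta>. ereal (cmod (f \<zeta>)))"
proof -
  have "esssup circle_measure (\<lambda>\<zeta>. 0 :: ereal) = 0"
    by (rule esssup_const) (simp add: circle_measure.emeasure_space_1 del: space_circle_measure)
  then show ?thesis
    using esssup_mono[of "\<lambda>\<zeta>. 0" circle_measure "\<lambda>\<zeta>. ereal (cmod (f \<zeta>))"] by simp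
qed

lemma ereal_ess_norm:
  "ess_bounded f \<Longrightarrow> ereal (ess_norm f) = esssup circle_measure (\<lambda>\<zeta>. ereal (cmod (f \<zeta>)))"
  using esssup_cmod_nonneg[of f] by (auto simp: ess_norm_def ess_bounded_def ereal_real)

lemma ess_norm_nonneg: "0 \<le> ess_norm f"
  using esssup_cmod_nonneg[of f] by (simp add: ess_norm_def real_of_ereal_pos)

lemma AE_le_ess_norm: "ess_bounded f \<Longrightarrow> AE \<zeta> in circle_measure. cmod (f \<zeta>) \<le> ess_norm f"
  using esssup_AE[of "\<lambda>\<zeta>. ereal (cmod (f \<zeta>))" circle_measure]
  by (simp add: ereal_ess_norm[symmetric])

lemma ess_boundedI:
  assumes [measurable]: "f \<in> borel_measurable circle_measure"
    and "AE \<zeta> in circle_measure. cmod (f \<zeta>) \<le> C"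
  shows "ess_bounded f"
proof -
  have "esssup circle_measure (\<lambda>\<zeta>. ereal (cmod (f \<zeta>))) \<le> ereal C"
    using assms by (intro esssup_I) auto
  then show ?thesis
    using assms(1) by (auto simp: ess_bounded_def)
qed

lemma ess_norm_le:
  assumes "ess_bounded f" "AE \<zeta> in circle_measure. cmod (f \<zeta>) \<le> C"
  shows "ess_norm f \<le> C"
proof -
  have [measurable]: "f \<in> borel_measurable circle_measure"
    using assms(1) by (rule ess_bounded_measurable)
  have "esssup circle_measure (\<lambda>\<zeta>. ereal (cmod (f \<zeta>))) \<le> ereal C"
    using assms by (intro esssup_I) auto
  then show ?thesis
    using ereal_ess_norm[OF assms(1)] by (metis ereal_less_eq(3))
qed

lemma ess_norm_cong: "ae_eq f g \<Longrightarrow> ess_norm f = ess_norm g"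
  unfolding ae_eq_def ess_norm_def
  by (intro arg_cong[where f = real_of_ereal] esssup_AE_cong)
     (auto simp: ess_bounded_def elim: eventually_mono)

lemma ess_bounded_zero: "ess_bounded (\<lambda>\<zeta>. 0)"
  by (rule ess_boundedI[where C = 0]) auto

lemma ess_bounded_add:
  assumes "ess_bounded f" "ess_bounded g"
  shows "ess_bounded (\<lambda>\<zeta>. f \<zeta> + g \<zeta>)"
    and "AE \<zeta> in circle_measure. cmod (f \<zeta> + g \<zeta>) \<le> ess_norm f + ess_norm g"
proof -
  show AE: "AE \<zeta> in circle_measure. cmod (f \<zeta> + g \<zeta>) \<le> ess_norm f + ess_norm g"
    using AE_le_ess_norm[OF assms(1)] AE_le_ess_norm[OF assms(2)]
    by eventually_elim (use norm_triangle_ineq add_mono order_trans in blast)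
  show "ess_bounded (\<lambda>\<zeta>. f \<zeta> + g \<zeta>)"
    using assms by (intro ess_boundedI[OF _ AE]) auto
qed

lemma ess_bounded_cmult:
  assumes "ess_bounded f"
  shows "ess_bounded (\<lambda>\<zeta>. c * f \<zeta>)"
    and "AE \<zeta> in circle_measure. cmod (c * f \<zeta>) \<le> cmod c * ess_norm f"
proof -
  show AE: "AE \<zeta> in circle_measure. cmod (c * f \<zeta>) \<le> cmod c * ess_norm f"
    using AE_le_ess_norm[OF assms] by eventually_elim (simp add: norm_mult mult_left_mono)
  show "ess_bounded (\<lambda>\<zeta>. c * f \<zeta>)"
    using assms by (intro ess_boundedI[OF _ AE]) auto
qed

lemma ess_norm_cmult:
  assumes "ess_bounded f"
  shows "ess_norm (\<lambda>\<zeta>. c * f \<zeta>) = cmod c * ess_norm f"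
proof (cases "c = 0")
  case True
  have "ess_norm (\<lambda>\<zeta>. 0) \<le> 0"
    by (rule ess_norm_le[OF ess_bounded_zero]) auto
  then show ?thesis
    using True ess_norm_nonneg[of "\<lambda>\<zeta>. 0"] by simp
next
  case False
  note b = ess_bounded_cmult[OF assms, of c]
  have "ess_norm f \<le> ess_norm (\<lambda>\<zeta>. c * f \<zeta>) / cmod c"
  proof (rule ess_norm_le[OF assms])
    show "AE \<zeta> in circle_measure. cmod (f \<zeta>) \<le> ess_norm (\<lambda>\<zeta>. c * f \<zeta>) / cmod c"
      using AE_le_ess_norm[OF b(1)]
      by eventually_elim (use False in \<open>simp add: norm_mult field_simps\<close>)
  qed
  then show ?thesis
    using ess_norm_le[OF b] False by (simp add: field_simps)
qed

quotient_type Linf = "complex \<Rightarrow> complex" / partial: ae_eq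
proof (rule part_equivpI)
  show "\<exists>f. ae_eq f f"
    using ess_bounded_zero by (auto simp: ae_eq_def)
  show "symp ae_eq"
    by (auto simp: symp_def ae_eq_def elim: eventually_mono)
  show "transp ae_eq"
    unfolding transp_def ae_eq_def by (auto elim: eventually_elim2)
qed

lift_definition cscale :: "complex \<Rightarrow> Linf \<Rightarrow> Linf" is "\<lambda>c f \<zeta>. c * f \<zeta>"
  by (auto simp: ae_eq_def intro!: ess_bounded_cmult elim: eventually_mono)

instantiation Linf :: real_normed_vector
begin

lift_definition zero_Linf :: Linf is "\<lambda>\<zeta>. 0"
  by (simp add: ae_eq_def ess_bounded_zero)

lift_definition plus_Linf :: "Linf \<Rightarrow> Linf \<Rightarrow> Linf" is "\<lambda>f g \<zeta>. f \<zeta> + g \<zeta>"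
  by (auto simp: ae_eq_def intro!: ess_bounded_add elim: eventually_elim2)

definition uminus_Linf :: "Linf \<Rightarrow> Linf" where
  "uminus_Linf f = cscale (- 1) f"

definition minus_Linf :: "Linf \<Rightarrow> Linf \<Rightarrow> Linf" where
  "minus_Linf f g = f + - g"

definition scaleR_Linf :: "real \<Rightarrow> Linf \<Rightarrow> Linf" where
  "scaleR_Linf r f = cscale (complex_of_real r) f"

lift_definition norm_Linf :: "Linf \<Rightarrow> real" is ess_norm
  by (rule ess_norm_cong)

definition sgn_Linf :: "Linf \<Rightarrow> Linf" where
  "sgn_Linf f = inverse (norm f) *\<^sub>R f"

definition dist_Linf :: "Linf \<Rightarrow> Linf \<Rightarrow> real" where
  "dist_Linf f g = norm (f - g)"

definition uniformity_Linf :: "(Linf \<times> Linf) filter" where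
  "uniformity_Linf = (INF e\<in>{0<..}. principal {(f, g). dist f g < e})"

definition open_Linf :: "Linf set \<Rightarrow> bool" where
  "open_Linf U \<longleftrightarrow> (\<forall>f\<in>U. \<forall>\<^sub>F (f', g) in uniformity. f' = f \<longrightarrow> g \<in> U)"

instance
proof
  fix f g h :: Linf and a b :: real and U :: "Linf set"
  show "f + g + h = f + (g + h)"
    by transfer (auto simp: ae_eq_def add.assoc intro!: ess_bounded_add)
  show "f + g = g + f"
    by transfer (auto simp: ae_eq_def add.commute intro!: ess_bounded_add)
  show "0 + f = f"
    by transfer (auto simp: ae_eq_def)
  show "- f + f = 0"
    unfolding uminus_Linf_def
    by transfer (auto simp: ae_eq_def intro: ess_bounded_zero)
  show "f - g = f + - g"
    by (rule minus_Linf_def)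
  show "a *\<^sub>R (f + g) = a *\<^sub>R f + a *\<^sub>R g"
    unfolding scaleR_Linf_def
    by transfer (auto simp: ae_eq_def distrib_left
        intro!: ess_bounded_add ess_bounded_cmult simp flip: distrib_left)
  show "(a + b) *\<^sub>R f = a *\<^sub>R f + b *\<^sub>R f"
    unfolding scaleR_Linf_def
    by transfer (auto simp: ae_eq_def intro!: ess_bounded_cmult simp flip: distrib_right)
  show "a *\<^sub>R b *\<^sub>R f = (a * b) *\<^sub>R f"
    unfolding scaleR_Linf_def
    by transfer (auto simp: ae_eq_def mult.assoc intro!: ess_bounded_cmult)
  show "1 *\<^sub>R f = f"
    unfolding scaleR_Linf_def by transfer (auto simp: ae_eq_def)
  show "sgn f = inverse (norm f) *\<^sub>R f"
    by (rule sgn_Linf_def)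
  show "dist f g = norm (f - g)"
    by (rule dist_Linf_def)
  show "uniformity = (INF e\<in>{0<..}. principal {(f :: Linf, g). dist f g < e})"
    by (rule uniformity_Linf_def)
  show "open U \<longleftrightarrow> (\<forall>f\<in>U. \<forall>\<^sub>F (f', g) in uniformity. f' = f \<longrightarrow> g \<in> U)"
    by (rule open_Linf_def)
  show "norm f = 0 \<longleftrightarrow> f = 0"
  proof transfer
    fix f assume "ae_eq f f"
    then have f: "ess_bounded f" by (simp add: ae_eq_def)
    show "ess_norm f = 0 \<longleftrightarrow> ae_eq f (\<lambda>\<zeta>. 0)"
    proof
      assume "ess_norm f = 0"
      then show "ae_eq f (\<lambda>\<zeta>. 0)"
        using AE_le_ess_norm[OF f] f ess_bounded_zero by (simp add: ae_eq_def)
    next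
      assume "ae_eq f (\<lambda>\<zeta>. 0)"
      then have "ess_norm f \<le> 0"
        by (intro ess_norm_le[OF f]) (auto simp: ae_eq_def elim: eventually_mono)
      then show "ess_norm f = 0"
        using ess_norm_nonneg[of f] by simp
    qed
  qed
  show "norm (f + g) \<le> norm f + norm g"
    by transfer (auto simp: ae_eq_def intro!: ess_norm_le ess_bounded_add)
  show "norm (a *\<^sub>R f) = \<bar>a\<bar> * norm f"
    unfolding scaleR_Linf_def by transfer (auto simp: ae_eq_def ess_norm_cmult)
qed

end


section \<open>The space \<open>H\<^sup>\<infinity>\<close>, its dual, and the subspaces \<open>H\<^sup>\<infinity>\<^sub>\<Phi>\<close>\<close>

lemma fourier_integral_cong:
  assumes fg: "ae_eq f g"
  shows "(LINT \<zeta>|circle_measure. cnj \<zeta> powi k * f \<zeta>) =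
         (LINT \<zeta>|circle_measure. cnj \<zeta> powi k * g \<zeta>)"
proof -
  have [measurable]: "f \<in> borel_measurable circle_measure" "g \<in> borel_measurable circle_measure"
    using fg by (auto simp: ae_eq_def ess_bounded_def)
  have "continuous_on unit_circle (\<lambda>\<zeta>. cnj \<zeta> powi k)"
    by (intro continuous_intros) auto
  then have "(\<lambda>\<zeta>. cnj \<zeta> powi k) \<in> borel_measurable (restrict_space borel unit_circle)"
    by (rule borel_measurable_continuous_on_restrict)
  then have [measurable]: "(\<lambda>\<zeta>. cnj \<zeta> powi k) \<in> borel_measurable circle_measure"
    by (simp add: measurable_cong_sets[OF sets_circle_measure refl])
  show ?thesis
    using fg by (intro integral_cong_AE) (auto simp: ae_eq_def elim: eventually_mono)
qed

lift_definition fourier_coeff :: "Linf \<Rightarrow> int \<Rightarrow> complex" is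
  "\<lambda>f k. LINT \<zeta>|circle_measure. cnj \<zeta> powi k * f \<zeta>"
  by (auto simp: fun_eq_iff intro: fourier_integral_cong)

text \<open>\<open>H\<^sup>\<infinity>\<close>, realised on the circle: the functions in \<open>L\<^sup>\<infinity>\<close> whose Fourier coefficients of
  negative index vanish, that is, the boundary functions of bounded holomorphic functions on
  the unit disk.\<close>

definition Hinf :: "Linf set" where
  "Hinf = {f. \<forall>k<0. fourier_coeff f k = 0}"

text \<open>Functionals are complex-linear. They are taken in \<^const>\<open>extensional\<close> so that distinct
  elements of the set below are distinct as functionals on \<^const>\<open>Hinf\<close>; this matters when
  functionals are counted.\<close>

definition Hinf_dual :: "(Linf \<Rightarrow> complex) set" where
  "Hinf_dual = {\<phi> \<in> extensional Hinf.
     (\<forall>f\<in>Hinf. \<forall>g\<in>Hinf. \<phi> (f + g) = \<phi> f + \<phi> g) \<and>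
     (\<forall>c. \<forall>f\<in>Hinf. \<phi> (cscale c f) = c * \<phi> f) \<and>
     (\<exists>C. \<forall>f\<in>Hinf. cmod (\<phi> f) \<le> C * norm f)}"

definition Hinf_sub :: "(Linf \<Rightarrow> complex) set \<Rightarrow> Linf set" where
  "Hinf_sub \<Phi> = {f \<in> Hinf. \<forall>\<phi>\<in>\<Phi>. \<phi> f = 0}"


section \<open>Admissibility and \<open>\<epsilon>\<^sup>*\<close>\<close>

text \<open>Here \<open>X\<close> is a subspace of the ambient normed space, with the induced norm.\<close>

definition admissible :: "'a::real_normed_vector set \<Rightarrow> 'a \<Rightarrow> real \<Rightarrow> bool" where
  "admissible X x \<epsilon> \<longleftrightarrow>
     (\<exists>\<delta>>0. \<forall>y\<in>X. max (norm (x + y)) (norm (x - y)) < 1 + \<delta> \<longrightarrow> norm y < \<epsilon>)"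

text \<open>The infima are taken in \<^typ>\<open>ereal\<close>, so that an infimum over an empty family is \<open>\<infinity>\<close>.\<close>

definition eps :: "(Linf \<Rightarrow> complex) set \<Rightarrow> Linf \<Rightarrow> ereal" where
  "eps \<Phi> f = (INF \<epsilon>\<in>{\<epsilon>. 0 < \<epsilon> \<and> admissible (Hinf_sub \<Phi>) f \<epsilon>}. ereal \<epsilon>)"

text \<open>\<^const>\<open>rep_Linf\<close> picks a representative, so this set is determined up to a null set.\<close>

definition sublevel :: "real \<Rightarrow> Linf \<Rightarrow> complex set" where
  "sublevel \<eta> f = {\<zeta> \<in> unit_circle. cmod (rep_Linf f \<zeta>) \<le> \<eta>}"

lemma measure_sublevel:
  assumes "ess_bounded f"
  shows "measure circle_measure (sublevel \<eta> (abs_Linf f)) =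
         measure circle_measure {\<zeta> \<in> unit_circle. cmod (f \<zeta>) \<le> \<eta>}"
proof -
  have rep: "ae_eq (rep_Linf (abs_Linf f)) f"
    using assms by (intro Quotient_rep_abs[OF Quotient_Linf]) (simp add: ae_eq_def)
  then have [measurable]: "rep_Linf (abs_Linf f) \<in> borel_measurable circle_measure"
    "f \<in> borel_measurable circle_measure"
    by (auto simp: ae_eq_def ess_bounded_def)
  have "measure circle_measure {\<zeta> \<in> space circle_measure. cmod (rep_Linf (abs_Linf f) \<zeta>) \<le> \<eta>} =
        measure circle_measure {\<zeta> \<in> space circle_measure. cmod (f \<zeta>) \<le> \<eta>}"
  proof (rule measure_eq_AE)
    show "AE \<zeta> in circle_measure.
        \<zeta> \<in> {\<zeta> \<in> space circle_measure. cmod (rep_Linf (abs_Linf f) \<zeta>) \<le> \<eta>} \<longleftrightarrow>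
        \<zeta> \<in> {\<zeta> \<in> space circle_measure. cmod (f \<zeta>) \<le> \<eta>}"
      using rep by (auto simp: ae_eq_def elim: eventually_mono)
  qed measurable
  then show ?thesis
    by (simp add: sublevel_def)
qed

definition small_set_class :: "(Linf \<Rightarrow> complex) set \<Rightarrow> real \<Rightarrow> real \<Rightarrow> Linf set" where
  "small_set_class \<Phi> \<eta> \<gamma> =
     {f \<in> Hinf_sub \<Phi>. norm f = 1 \<and> measure circle_measure (sublevel \<eta> f) \<ge> \<gamma>}"

definition eps_star :: "nat \<Rightarrow> real \<Rightarrow> real \<Rightarrow> ereal" where
  "eps_star N \<eta> \<gamma> =
     (INF \<Phi>\<in>{\<Phi>. \<Phi> \<subseteq> Hinf_dual \<and> finite \<Phi> \<and> card \<Phi> = N}.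
        INF f\<in>small_set_class \<Phi> \<eta> \<gamma>. eps \<Phi> f)"

end

theory Submission
  imports Defs "HOL-Complex_Analysis.Complex_Analysis"
begin

text \<open>Both bounds rest on one construction: for a closed set \<open>K\<close> and \<open>r > 0\<close> there is a function in
  \<^const>\<open>Hinf\<close> whose modulus is \<open>1\<close> almost everywhere on \<open>K\<close> and \<open>r\<close> almost everywhere off \<open>K\<close>
  (\<open>two_valued_modulus\<close>).

  For the lower bound, suppose that \<open>\<bar>f\<bar> \<le> \<eta>\<close> on a set \<open>E\<close> of positive measure. A function \<open>y\<close> with
  \<open>\<bar>y\<bar> \<le> 1 - \<eta>\<close> on \<open>E\<close> and \<open>\<bar>y\<bar> < \<delta>\<close> off \<open>E\<close> satisfies \<open>\<bar>f \<plusminus> y\<bar> < 1 + \<delta>\<close>. If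
  such \<open>y\<close> of one and the same norm exist for all \<open>\<delta>\<close>, then every admissible number exceeds that
  norm. Inside \<open>E\<close> there are arbitrarily many disjoint compact sets of positive
  measure, each of which carries an analytic function concentrated on it. Once there are more of these
  functions than functionals, a nontrivial combination \<open>y\<close> is killed by all functionals. Because the
  functions are concentrated on disjoint sets, the size of \<open>y\<close> on \<open>E\<close> is
  controlled by its largest coefficient, and \<open>y\<close> can be scaled to have norm exactly \<open>1 - \<eta>\<close>
  (\<open>admissible_ge\<close>). This gives \<open>1 - \<eta> \<le> \<epsilon>\<^sup>*\<close>, which dominates \<open>\<gamma>\<^sup>N (1 - \<eta>)\<close>; the constant in
  the theorem is \<open>1\<close>.

  For the upper bound, let \<open>f\<close> have modulus \<open>1\<close> on a set of small positive measure and modulus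
  \<open>\<eta>\<close> elsewhere. Since \<open>\<bar>f\<bar> \<ge> \<eta>\<close> almost everywhere, the parallelogram law bounds every admissible
  perturbation by nearly \<open>sqrt (1 - \<eta>\<^sup>2)\<close> (\<open>admissible_if_modulus_ge\<close>), and any number of functionals
  vanishing at \<open>f\<close> can be supplied.\<close>

section \<open>Integration on the circle\<close>

lemma cis_measurable_circle [measurable]:
  "cis \<in> uniform_measure lborel {0..2*pi} \<rightarrow>\<^sub>M restrict_space borel unit_circle"
proof (rule measurable_restrict_space2)
  have "cis \<in> borel_measurable borel"
    by (intro borel_measurable_continuous_onI continuous_on_cis continuous_intros)
  then show "cis \<in> borel_measurable (uniform_measure lborel {0..2 * pi})"
    by simp
qed auto

lemma borel_measurable_circle_continuous:
  fixes g :: "complex \<Rightarrow> 'a::topological_space"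
  assumes "continuous_on unit_circle g"
  shows "g \<in> borel_measurable circle_measure"
  using borel_measurable_continuous_on_restrict[OF assms]
  by (simp add: measurable_cong_sets[OF sets_circle_measure refl])

lemma integrable_circle_bounded:
  fixes g :: "complex \<Rightarrow> 'a::{banach, second_countable_topology}"
  assumes "g \<in> borel_measurable circle_measure" "AE \<zeta> in circle_measure. norm (g \<zeta>) \<le> B"
  shows "integrable circle_measure g"
  by (rule circle_measure.integrable_const_bound[OF assms(2,1)])

lemma integrable_circle_continuous:
  fixes g :: "complex \<Rightarrow> 'a::{banach, second_countable_topology}"
  assumes g: "continuous_on unit_circle g"
  shows "integrable circle_measure g"
proof -
  have "compact (g ` unit_circle)"
    using g by (intro compact_continuous_image) auto
  then obtain B where "\<forall>\<zeta>\<in>unit_circle. norm (g \<zeta>) \<le> B"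
    using compact_imp_bounded[of "g ` unit_circle"] unfolding bounded_iff by auto
  then show ?thesis
    by (intro integrable_circle_bounded[where B = B] borel_measurable_circle_continuous g AE_I2) simp
qed

lemma integral_circle_measure:
  fixes g :: "complex \<Rightarrow> complex"
  assumes g: "continuous_on unit_circle g"
  shows "(LINT \<zeta>|circle_measure. g \<zeta>) = integral {0..2*pi} (\<lambda>t. g (cis t)) / (2*pi)"
proof -
  have c: "continuous_on A (\<lambda>t. g (cis t))" for A
    by (rule continuous_on_compose2[OF g]) (auto intro!: continuous_on_cis continuous_intros)
  have m [measurable]: "(\<lambda>t. g (cis t)) \<in> borel_measurable borel"
    by (rule borel_measurable_continuous_onI[OF c])
  have gm: "g \<in> borel_measurable (restrict_space borel unit_circle)"
    by (rule borel_measurable_continuous_on_restrict[OF g])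
  have d: "uniform_measure lborel {0..2*pi} = density lborel (\<lambda>t. ennreal (indicator {0..2*pi} t / (2*pi)))"
    unfolding uniform_measure_def
    by (rule arg_cong[where f="density lborel"]) (auto simp: fun_eq_iff divide_ennreal[symmetric] ennreal_indicator split: split_indicator)
  have "(LINT \<zeta>|circle_measure. g \<zeta>) = (LINT t|uniform_measure lborel {0..2*pi}. g (cis t))"
    unfolding circle_measure_def by (rule integral_distr[OF cis_measurable_circle gm])
  also have "\<dots> = (LINT t|lborel. (indicator {0..2*pi} t / (2*pi)) *\<^sub>R g (cis t))"
    unfolding d by (rule integral_density) auto
  also have "\<dots> = (LINT t|lborel. (indicator {0..2*pi} t *\<^sub>R g (cis t)) / (2*pi))"
    by (intro Bochner_Integration.integral_cong) (auto split: split_indicator simp: scaleR_conv_of_real)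
  also have "\<dots> = (LINT t:{0..2*pi}|lborel. g (cis t)) / (2*pi)"
    unfolding set_lebesgue_integral_def by (rule integral_divide_zero)
  also have "(LINT t:{0..2*pi}|lborel. g (cis t)) = integral {0..2*pi} (\<lambda>t. g (cis t))"
    unfolding set_integrable_def
    by (intro set_borel_integral_eq_integral(2)) (simp add: set_integrable_def borel_integrable_compact c)
  finally show ?thesis .
qed

text \<open>Cauchy's formula at the centre, read on the boundary. It is the only source of vanishing
  Fourier coefficients below.\<close>

lemma circle_mean_value:
  assumes hol: "g holomorphic_on UNIV"
  shows "(LINT \<zeta>|circle_measure. g \<zeta>) = g 0"
proof -
  have c: "continuous_on A g" for A
    using hol holomorphic_on_imp_continuous_on continuous_on_subset by blast
  have "((\<lambda>u. g u / (u - 0)) has_contour_integral (2 * of_real pi * \<i> * g 0)) (circlepath 0 1)"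
    using hol by (intro Cauchy_integral_circlepath c) (auto intro: holomorphic_on_subset)
  then have "((\<lambda>t. \<i> * g (cis t)) has_integral (2 * of_real pi * \<i> * g 0)) {0..2*pi}"
    by (simp add: circlepath_def has_contour_integral_part_circlepath_iff mult_ac)
  then have "((\<lambda>t. -\<i> * (\<i> * g (cis t))) has_integral -\<i> * (2 * of_real pi * \<i> * g 0)) {0..2*pi}"
    by (rule has_integral_mult_right)
  then have "integral {0..2*pi} (\<lambda>t. g (cis t)) = 2 * of_real pi * g 0"
    by (intro integral_unique) (simp add: algebra_simps)
  then show ?thesis
    using integral_circle_measure[OF c] by simp
qed

text \<open>The arithmetic-geometric mean inequality gives \<open>\<bar>g\<bar> \<le> g\<^sup>2/(2s) + s/2\<close>, which is
  Cauchy-Schwarz on a probability space without square roots.\<close>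

lemma L1_le_of_L2_le:
  fixes g :: "complex \<Rightarrow> real"
  assumes int: "integrable circle_measure (\<lambda>\<zeta>. (g \<zeta>)\<^sup>2)" "integrable circle_measure (\<lambda>\<zeta>. \<bar>g \<zeta>\<bar>)"
    and s: "0 < s" "(LINT \<zeta>|circle_measure. (g \<zeta>)\<^sup>2) \<le> s\<^sup>2"
  shows "(LINT \<zeta>|circle_measure. \<bar>g \<zeta>\<bar>) \<le> s"
proof -
  have "(LINT \<zeta>|circle_measure. \<bar>g \<zeta>\<bar>) \<le> (LINT \<zeta>|circle_measure. (g \<zeta>)\<^sup>2 / (2 * s) + s / 2)"
  proof (rule integral_mono)
    show "\<bar>g \<zeta>\<bar> \<le> (g \<zeta>)\<^sup>2 / (2 * s) + s / 2" for \<zeta>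
      using s(1) sum_squares_bound[of "\<bar>g \<zeta>\<bar>" s] by (simp add: field_simps power2_eq_square)
  qed (use int in auto)
  also have "\<dots> = (LINT \<zeta>|circle_measure. (g \<zeta>)\<^sup>2) / (2 * s) + s / 2"
    using int(1) by (simp add: circle_measure.prob_space del: space_circle_measure)
  also have "\<dots> \<le> s"
    using s by (simp add: field_simps power2_eq_square)
  finally show ?thesis .
qed

text \<open>By monotone convergence the sum of the series has a finite integral. This replaces
  completeness of \<open>L\<^sup>2\<close>: a sequence whose successive \<open>L\<^sup>1\<close> distances are summable converges
  almost everywhere.\<close>

lemma AE_summable_of_summable_integrals:
  fixes g :: "nat \<Rightarrow> 'a \<Rightarrow> real"
  assumes int: "\<And>k. integrable M (g k)" and nn: "\<And>k x. 0 \<le> g k x"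
    and s: "summable (\<lambda>k. integral\<^sup>L M (g k))"
  shows "AE x in M. summable (\<lambda>k. g k x)"
proof -
  have [measurable]: "g k \<in> borel_measurable M" for k
    using int by auto
  have "(\<integral>\<^sup>+x. (\<Sum>k. ennreal (g k x)) \<partial>M) = (\<Sum>k. \<integral>\<^sup>+x. ennreal (g k x) \<partial>M)"
    by (rule nn_integral_suminf) auto
  also have "\<dots> = (\<Sum>k. ennreal (integral\<^sup>L M (g k)))"
    by (intro suminf_cong nn_integral_eq_integral int AE_I2 nn)
  also have "\<dots> \<noteq> \<infinity>"
    using s by (simp add: suminf_ennreal2 integral_nonneg nn)
  finally have "AE x in M. (\<Sum>k. ennreal (g k x)) \<noteq> \<infinity>"
    by (intro nn_integral_PInf_AE) auto
  then show ?thesis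
    by eventually_elim (auto intro!: summable_suminf_not_top nn)
qed

text \<open>The conjugate function is no larger than the function in \<open>L\<^sup>2\<close>: the mean of \<open>h\<^sup>2\<close> is
  \<open>(h 0)\<^sup>2\<close>, a nonnegative real number, and its real part is the difference of the two
  integrals.\<close>

lemma conjugate_L2_bound:
  assumes hol: "h holomorphic_on UNIV" and "Im (h 0) = 0"
  shows "(LINT \<zeta>|circle_measure. (Im (h \<zeta>))\<^sup>2) \<le> (LINT \<zeta>|circle_measure. (Re (h \<zeta>))\<^sup>2)"
proof -
  have c [continuous_intros]: "continuous_on A h" for A
    using hol holomorphic_on_imp_continuous_on continuous_on_subset by blast
  have i: "integrable circle_measure (\<lambda>\<zeta>. (h \<zeta>)\<^sup>2)"
    "integrable circle_measure (\<lambda>\<zeta>. (Re (h \<zeta>))\<^sup>2)" "integrable circle_measure (\<lambda>\<zeta>. (Im (h \<zeta>))\<^sup>2)"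
    by (intro integrable_circle_continuous continuous_intros)+
  have "(h 0)\<^sup>2 = (LINT \<zeta>|circle_measure. (h \<zeta>)\<^sup>2)"
    by (rule circle_mean_value[symmetric]) (intro holomorphic_intros hol)
  then have "Re ((h 0)\<^sup>2) = (LINT \<zeta>|circle_measure. Re ((h \<zeta>)\<^sup>2))"
    using i(1) by simp
  also have "\<dots> = (LINT \<zeta>|circle_measure. (Re (h \<zeta>))\<^sup>2) - (LINT \<zeta>|circle_measure. (Im (h \<zeta>))\<^sup>2)"
    using i by (simp add: power2_eq_square flip: integral_Re Bochner_Integration.integral_diff)
  finally show ?thesis
    using assms(2) by simp (metis diff_ge_0_iff_ge zero_le_power2)
qed


section \<open>Real parts of polynomials are dense\<close>

text \<open>From \<open>Re a * Re b = (Re (a * b) + Re (a * cnj b)) / 2\<close>. On the circle \<open>z\<^sup>i * cnj z\<^sup>j\<close> is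
  a power of \<open>z\<close> or of \<open>cnj z\<close>; in the second case conjugating the whole term leaves its real
  part alone and makes it analytic.\<close>

lemma Re_poly_times_Re_poly:
  fixes p q :: "complex poly"
  shows "\<exists>r. \<forall>z\<in>unit_circle. Re (poly p z) * Re (poly q z) = Re (poly r z)"
proof -
  define e where "e i j = (if j \<le> i then monom (coeff p i * cnj (coeff q j)) (i - j)
      else monom (cnj (coeff p i) * coeff q j) (j - i))" for i j
  define r where "r = (\<Sum>i\<le>degree p. \<Sum>j\<le>degree q. smult (1/2) (e i j))"
  have "Re (poly p z) * Re (poly q z) = Re (poly (smult (1/2) (p * q) + r) z)"
    if z: "z \<in> unit_circle" for z
  proof -
    have zc: "z * cnj z = 1"
      using z by (simp add: complex_norm_square[symmetric])
    have zp: "z ^ i * cnj z ^ j = (if j \<le> i then z ^ (i - j) else cnj z ^ (j - i))" for i j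
    proof (cases "j \<le> i")
      case True
      then have "z ^ i * cnj z ^ j = z ^ (i - j) * (z * cnj z) ^ j"
        by (simp add: power_mult_distrib flip: power_add mult.assoc)
      then show ?thesis using True zc by simp
    next
      case False
      then have "z ^ i * cnj z ^ j = cnj z ^ (j - i) * (z * cnj z) ^ i"
        by (simp add: power_mult_distrib mult_ac flip: power_add mult.assoc)
      then show ?thesis using False zc by simp
    qed
    have e: "Re (coeff p i * z ^ i * cnj (coeff q j * z ^ j)) = Re (poly (e i j) z)" for i j
    proof -
      have "coeff p i * z ^ i * cnj (coeff q j * z ^ j) =
          coeff p i * cnj (coeff q j) * (z ^ i * cnj z ^ j)"
        by (simp add: mult_ac)
      also have "\<dots> = (if j \<le> i then poly (e i j) z else cnj (poly (e i j) z))"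
        unfolding zp by (simp add: e_def poly_monom)
      finally have "coeff p i * z ^ i * cnj (coeff q j * z ^ j) =
          (if j \<le> i then poly (e i j) z else cnj (poly (e i j) z))" .
      then show ?thesis
        by (simp only: complex_cnj if_distrib[of Re] if_cancel cnj.simps complex.sel)
    qed
    have "poly p z * cnj (poly q z) =
        (\<Sum>i\<le>degree p. \<Sum>j\<le>degree q. coeff p i * z ^ i * cnj (coeff q j * z ^ j))"
      by (simp add: poly_altdef sum_product)
    then have "Re (poly p z * cnj (poly q z)) = (\<Sum>i\<le>degree p. \<Sum>j\<le>degree q. Re (poly (e i j) z))"
      by (simp only: Re_sum e)
    also have "\<dots> = 2 * Re (poly r z)"
      by (simp add: r_def poly_sum Re_sum sum_distrib_left)
    finally have "Re (poly p z * cnj (poly q z)) = 2 * Re (poly r z)" .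
    then show ?thesis
      by (simp add: field_simps)
  qed
  then show ?thesis by blast
qed

lemma real_polynomial_on_circle_is_Re_poly:
  assumes "real_polynomial_function g"
  shows "\<exists>p. \<forall>z\<in>unit_circle. g z = Re (poly p z)"
  using assms
proof (induction rule: real_polynomial_function.induct)
  case (linear f)
  interpret bounded_linear f by fact
  have "f z = Re (poly [:0, Complex (f 1) (- f \<i>):] z)" for z
  proof -
    have "f z = f (Re z *\<^sub>R 1 + Im z *\<^sub>R \<i>)"
      by (rule arg_cong[where f=f]) (simp add: complex_eq_iff)
    then show ?thesis by (simp add: add scaleR)
  qed
  then show ?case by blast
next
  case (const c)
  have "c = Re (poly [:of_real c:] z)" for z by simp
  then show ?case by blast
next
  case (add f g)
  then obtain p q where "\<forall>z\<in>unit_circle. f z = Re (poly p z)" "\<forall>z\<in>unit_circle. g z = Re (poly q z)"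
    by blast
  then have "\<forall>z\<in>unit_circle. f z + g z = Re (poly (p + q) z)" by simp
  then show ?case by blast
next
  case (mult f g)
  then obtain p q where "\<forall>z\<in>unit_circle. f z = Re (poly p z)" "\<forall>z\<in>unit_circle. g z = Re (poly q z)"
    by blast
  then show ?case using Re_poly_times_Re_poly[of p q] by simp
qed

text \<open>Stone-Weierstrass. Subtracting an imaginary constant from the polynomial does not change
  its real part, so that its value at \<open>0\<close> can be made real, as the bound for the conjugate
  function demands.\<close>

lemma Re_poly_approximation:
  fixes w :: "complex \<Rightarrow> real"
  assumes "continuous_on unit_circle w" "0 < e"
  obtains p where "Im (poly p 0) = 0" "\<And>z. z \<in> unit_circle \<Longrightarrow> \<bar>w z - Re (poly p z)\<bar> < e"
proof -
  obtain g where g: "real_polynomial_function g" "\<And>z. z \<in> unit_circle \<Longrightarrow> \<bar>w z - g z\<bar> < e"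
    using Stone_Weierstrass_real_polynomial_function[OF compact_sphere assms] by blast
  obtain p where p: "\<forall>z\<in>unit_circle. g z = Re (poly p z)"
    using real_polynomial_on_circle_is_Re_poly[OF g(1)] by blast
  show thesis
    by (rule that[of "p - [:\<i> * Im (poly p 0):]"]) (use g p in auto)
qed


section \<open>Representatives, Fourier coefficients and functionals\<close>

text \<open>Elements of \<^typ>\<open>Linf\<close> are handled through their representatives, on which the operations
  act pointwise almost everywhere.\<close>

lemma ess_bounded_rep: "ess_bounded (rep_Linf f)"
  using Quotient_rep_reflp[OF Quotient_Linf, of f] by (simp add: ae_eq_def)

lemma borel_measurable_rep [measurable]: "rep_Linf f \<in> borel_measurable circle_measure"
  by (rule ess_bounded_measurable[OF ess_bounded_rep])

lemma ae_eq_rep_abs: "ess_bounded g \<Longrightarrow> ae_eq (rep_Linf (abs_Linf g)) g"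
  by (intro Quotient_rep_abs[OF Quotient_Linf]) (simp add: ae_eq_def)

lemma AE_rep_abs: "ess_bounded g \<Longrightarrow> AE \<zeta> in circle_measure. rep_Linf (abs_Linf g) \<zeta> = g \<zeta>"
  using ae_eq_rep_abs by (simp add: ae_eq_def)

lemma abs_rep: "abs_Linf (rep_Linf f) = f"
  by (rule Quotient_abs_rep[OF Quotient_Linf])

lemma ae_eq_rep: "ae_eq (rep_Linf f) (rep_Linf f)"
  by (simp add: ae_eq_def ess_bounded_rep)

lemma AE_rep_add: "AE \<zeta> in circle_measure. rep_Linf (f + g) \<zeta> = rep_Linf f \<zeta> + rep_Linf g \<zeta>"
  using plus_Linf.abs_eq[OF ae_eq_rep ae_eq_rep, of f g]
    AE_rep_abs[OF ess_bounded_add(1)[OF ess_bounded_rep ess_bounded_rep], of f g]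
  by (simp add: abs_rep)

lemma AE_rep_cscale: "AE \<zeta> in circle_measure. rep_Linf (cscale c f) \<zeta> = c * rep_Linf f \<zeta>"
  using cscale.abs_eq[OF ae_eq_rep, of c f]
    AE_rep_abs[OF ess_bounded_cmult(1)[OF ess_bounded_rep], of c f]
  by (simp add: abs_rep)

lemma AE_rep_diff: "AE \<zeta> in circle_measure. rep_Linf (f - g) \<zeta> = rep_Linf f \<zeta> - rep_Linf g \<zeta>"
  using AE_rep_add[of f "cscale (-1) g"] AE_rep_cscale[of "-1" g]
  by eventually_elim (simp add: minus_Linf_def uminus_Linf_def)

lemma AE_rep_zero: "AE \<zeta> in circle_measure. rep_Linf 0 \<zeta> = 0"
  using AE_rep_abs[OF ess_bounded_zero] by (simp add: zero_Linf_def)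

lemma AE_rep_sum:
  assumes "finite I"
  shows "AE \<zeta> in circle_measure. rep_Linf (\<Sum>i\<in>I. f i) \<zeta> = (\<Sum>i\<in>I. rep_Linf (f i) \<zeta>)"
  using assms
proof induction
  case (insert i I)
  show ?case
    using insert.IH AE_rep_add[of "f i" "sum f I"]
    by eventually_elim (use insert in simp)
qed (simp add: AE_rep_zero)

lemma norm_Linf_rep: "norm f = ess_norm (rep_Linf f)"
  using norm_Linf.abs_eq[OF ae_eq_rep, of f] by (simp add: abs_rep)

lemma AE_le_norm: "AE \<zeta> in circle_measure. cmod (rep_Linf f \<zeta>) \<le> norm f"
  unfolding norm_Linf_rep by (rule AE_le_ess_norm[OF ess_bounded_rep])

lemma norm_Linf_le:
  "AE \<zeta> in circle_measure. cmod (rep_Linf f \<zeta>) \<le> C \<Longrightarrow> norm f \<le> C"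
  unfolding norm_Linf_rep by (rule ess_norm_le[OF ess_bounded_rep])

text \<open>A lower bound on any set of positive measure is seen by the essential supremum.\<close>

lemma norm_Linf_ge:
  assumes K: "K \<in> sets circle_measure" "0 < measure circle_measure K"
    and "AE \<zeta> in circle_measure. \<zeta> \<in> K \<longrightarrow> C \<le> cmod (rep_Linf f \<zeta>)"
  shows "C \<le> norm f"
proof (rule ccontr)
  assume "\<not> C \<le> norm f"
  then have C: "norm f < C" by simp
  have "AE \<zeta> in circle_measure. \<zeta> \<notin> K"
    using assms(3) AE_le_norm[of f] by eventually_elim (use C in auto)
  then have "K \<in> null_sets circle_measure"
    using K(1) by (simp add: AE_iff_null_sets)
  then have "measure circle_measure K = 0"
    by (simp add: measure_def null_setsD1)
  then show False using K(2) by simp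
qed

lemma fourier_coeff_rep:
  "fourier_coeff f k = (LINT \<zeta>|circle_measure. cnj \<zeta> powi k * rep_Linf f \<zeta>)"
  using fourier_coeff.abs_eq[OF ae_eq_rep, of f] by (simp add: abs_rep)

lemma borel_measurable_powi [measurable]:
  "(\<lambda>\<zeta>. cnj \<zeta> powi k) \<in> borel_measurable circle_measure"
  by (rule borel_measurable_circle_continuous,
      rule continuous_on_power_int[OF continuous_on_cnj[OF continuous_on_id]]) auto

lemma AE_circle: "AE \<zeta> in circle_measure. cmod \<zeta> = 1"
  by (rule AE_I2) simp

lemma integrable_fourier: "integrable circle_measure (\<lambda>\<zeta>. cnj \<zeta> powi k * rep_Linf f \<zeta>)"
proof (rule integrable_circle_bounded)
  show "AE \<zeta> in circle_measure. norm (cnj \<zeta> powi k * rep_Linf f \<zeta>) \<le> norm f"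
    using AE_le_norm[of f] AE_circle
    by eventually_elim (simp add: norm_mult norm_power_int)
qed measurable

lemma fourier_coeff_add: "fourier_coeff (f + g) k = fourier_coeff f k + fourier_coeff g k"
proof -
  have "fourier_coeff (f + g) k =
      (LINT \<zeta>|circle_measure. cnj \<zeta> powi k * rep_Linf f \<zeta> + cnj \<zeta> powi k * rep_Linf g \<zeta>)"
    unfolding fourier_coeff_rep
  proof (rule integral_cong_AE)
    show "AE \<zeta> in circle_measure. cnj \<zeta> powi k * rep_Linf (f + g) \<zeta> =
        cnj \<zeta> powi k * rep_Linf f \<zeta> + cnj \<zeta> powi k * rep_Linf g \<zeta>"
      using AE_rep_add[of f g] by eventually_elim (simp add: distrib_left)
  qed measurable
  then show ?thesis by (simp add: fourier_coeff_rep integrable_fourier)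
qed

lemma fourier_coeff_cscale: "fourier_coeff (cscale c f) k = c * fourier_coeff f k"
proof -
  have "fourier_coeff (cscale c f) k =
      (LINT \<zeta>|circle_measure. c * (cnj \<zeta> powi k * rep_Linf f \<zeta>))"
    unfolding fourier_coeff_rep
  proof (rule integral_cong_AE)
    show "AE \<zeta> in circle_measure. cnj \<zeta> powi k * rep_Linf (cscale c f) \<zeta> =
        c * (cnj \<zeta> powi k * rep_Linf f \<zeta>)"
      using AE_rep_cscale[of c f] by eventually_elim simp
  qed measurable
  then show ?thesis by (simp add: fourier_coeff_rep integrable_fourier)
qed

lemma cmod_fourier_coeff_le: "cmod (fourier_coeff f k) \<le> norm f"
proof -
  have "cmod (fourier_coeff f k) \<le> (LINT \<zeta>|circle_measure. cmod (cnj \<zeta> powi k * rep_Linf f \<zeta>))"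
    unfolding fourier_coeff_rep by (rule integral_norm_bound)
  also have "\<dots> \<le> norm f"
  proof (rule circle_measure.integral_le_const)
    show "integrable circle_measure (\<lambda>\<zeta>. cmod (cnj \<zeta> powi k * rep_Linf f \<zeta>))"
      by (intro integrable_norm integrable_fourier)
    show "AE \<zeta> in circle_measure. cmod (cnj \<zeta> powi k * rep_Linf f \<zeta>) \<le> norm f"
      using AE_le_norm[of f] AE_circle
      by eventually_elim (simp add: norm_mult norm_power_int)
  qed
  finally show ?thesis .
qed

lemma Hinf_add: "f \<in> Hinf \<Longrightarrow> g \<in> Hinf \<Longrightarrow> f + g \<in> Hinf"
  by (simp add: Hinf_def fourier_coeff_add)

lemma Hinf_cscale: "f \<in> Hinf \<Longrightarrow> cscale c f \<in> Hinf"
  by (simp add: Hinf_def fourier_coeff_cscale)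

lemma cscale_zero: "cscale 0 f = 0"
  using cscale.abs_eq[OF ae_eq_rep, of 0 f] by (simp add: abs_rep zero_Linf_def)

lemma Hinf_zero: "0 \<in> Hinf"
  using fourier_coeff_cscale[of 0 0] by (simp add: Hinf_def cscale_zero)

lemma Hinf_sum: "(\<And>i. i \<in> I \<Longrightarrow> f i \<in> Hinf) \<Longrightarrow> (\<Sum>i\<in>I. f i) \<in> Hinf"
  by (induction I rule: infinite_finite_induct) (simp_all add: Hinf_add Hinf_zero)

lemma Hinf_dual_zero: "\<phi> \<in> Hinf_dual \<Longrightarrow> \<phi> 0 = 0"
proof -
  assume "\<phi> \<in> Hinf_dual"
  then have "\<phi> (cscale 0 0) = 0 * \<phi> 0"
    using Hinf_zero unfolding Hinf_dual_def by blast
  then show ?thesis by (simp add: cscale_zero)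
qed

lemma Hinf_dual_sum:
  assumes \<phi>: "\<phi> \<in> Hinf_dual" and "\<And>i. i \<in> I \<Longrightarrow> f i \<in> Hinf"
  shows "\<phi> (\<Sum>i\<in>I. f i) = (\<Sum>i\<in>I. \<phi> (f i))"
  using assms(2)
proof (induction I rule: infinite_finite_induct)
  case (insert i I)
  then have "\<phi> (f i + sum f I) = \<phi> (f i) + \<phi> (sum f I)"
    using \<phi> Hinf_sum[of I f] by (auto simp: Hinf_dual_def)
  then show ?case using insert by simp
qed (simp_all add: Hinf_dual_zero[OF \<phi>])


section \<open>Analytic functions with prescribed modulus\<close>

lemma cnj_powi_unit:
  assumes "cmod z = 1"
  shows "cnj z powi k = z powi (- k)"
proof -
  have "z * cnj z = 1" using assms by (simp add: complex_norm_square[symmetric])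
  then have "inverse z = cnj z" by (rule inverse_unique)
  then show ?thesis by (metis power_int_inverse power_int_minus)
qed

text \<open>This is the outer function with modulus \<open>exp w\<close>, built without a conjugation operator.
  Choose polynomials \<open>P k\<close> with \<open>Re (P k)\<close> converging to \<open>w\<close> in \<open>L\<^sup>2\<close> at a geometric rate. The
  \<open>L\<^sup>2\<close> bound for conjugate functions makes the imaginary parts converge at the same rate, so
  \<open>P k\<close> converges almost everywhere on the circle, and so does \<open>exp (P k)\<close>. The moduli tend to
  \<open>exp w\<close>. Since \<open>Re (P k)\<close> is uniformly bounded, the functions \<open>exp (P k)\<close> are too, and
  dominated convergence carries their vanishing Fourier coefficients over to the limit.\<close>

lemma outer_function:
  fixes w :: "complex \<Rightarrow> real" and W :: "nat \<Rightarrow> complex \<Rightarrow> real"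
  assumes cont: "\<And>n. continuous_on unit_circle (W n)"
    and bound: "\<And>n z. z \<in> unit_circle \<Longrightarrow> \<bar>W n z\<bar> \<le> B"
    and lim: "\<And>z. z \<in> unit_circle \<Longrightarrow> (\<lambda>n. W n z) \<longlonglongrightarrow> w z"
  obtains F where "F \<in> Hinf" "AE \<zeta> in circle_measure. cmod (rep_Linf F \<zeta>) = exp (w \<zeta>)"
proof -
  have Wm [measurable]: "W n \<in> borel_measurable circle_measure" for n
    by (rule borel_measurable_circle_continuous[OF cont])
  have wm [measurable]: "w \<in> borel_measurable circle_measure"
    by (rule borel_measurable_LIMSEQ_metric[where f = W, OF Wm]) (simp add: lim)
  have wb: "\<bar>w z\<bar> \<le> B" if "z \<in> unit_circle" for z
    using tendsto_rabs[OF lim[OF that]] bound[OF that] by (intro LIMSEQ_le_const2) auto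
  have dist: "(W n z - w z)\<^sup>2 \<le> (2 * B)\<^sup>2" if "z \<in> unit_circle" for n z
    using bound[OF that, of n] wb[OF that] by (intro abs_le_square_iff[THEN iffD1]) linarith
  have "(\<lambda>n. LINT \<zeta>|circle_measure. (W n \<zeta> - w \<zeta>)\<^sup>2) \<longlonglongrightarrow> (LINT \<zeta>|circle_measure. 0)"
  proof (rule integral_dominated_convergence[where w = "\<lambda>_. (2 * B)\<^sup>2"])
    show "AE z in circle_measure. (\<lambda>n. (W n z - w z)\<^sup>2) \<longlonglongrightarrow> 0"
      by (rule AE_I2) (auto intro!: tendsto_eq_intros lim)
    show "AE z in circle_measure. norm ((W n z - w z)\<^sup>2) \<le> (2 * B)\<^sup>2" for n
      using dist by (intro AE_I2) simp
  qed auto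
  then have L2_lim: "(\<lambda>n. LINT \<zeta>|circle_measure. (W n \<zeta> - w \<zeta>)\<^sup>2) \<longlonglongrightarrow> 0"
    by simp
  have "\<exists>n. (LINT \<zeta>|circle_measure. (W n \<zeta> - w \<zeta>)\<^sup>2) < (1/4) ^ k" for k
  proof -
    have "eventually (\<lambda>n. (LINT \<zeta>|circle_measure. (W n \<zeta> - w \<zeta>)\<^sup>2) < (1/4) ^ k) sequentially"
      by (rule order_tendstoD(2)[OF L2_lim]) simp
    then show ?thesis by (auto simp: eventually_sequentially)
  qed
  then obtain N where N: "\<And>k. (LINT \<zeta>|circle_measure. (W (N k) \<zeta> - w \<zeta>)\<^sup>2) < (1/4) ^ k"
    by metis
  have "\<exists>p. Im (poly p 0) = 0 \<and> (\<forall>z\<in>unit_circle. \<bar>W (N k) z - Re (poly p z)\<bar> < (1/2) ^ k)" for k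
    by (rule Re_poly_approximation[OF cont, of "(1/2) ^ k" "N k"]) auto
  then obtain P where P: "\<And>k. Im (poly (P k) 0) = 0"
    "\<And>k z. z \<in> unit_circle \<Longrightarrow> \<bar>W (N k) z - Re (poly (P k) z)\<bar> < (1/2) ^ k"
    by metis
  have Pc [continuous_intros]: "continuous_on A (poly p)" for A and p :: "complex poly"
    by (rule continuous_on_poly) (rule continuous_on_id)
  have Pm [measurable]: "poly p \<in> borel_measurable circle_measure" for p :: "complex poly"
    by (rule borel_measurable_circle_continuous[OF Pc])
  have Pb: "\<bar>Re (poly (P k) z)\<bar> \<le> B + 1" if "z \<in> unit_circle" for k z
    using P(2)[OF that, of k] bound[OF that, of "N k"] power_le_one[of "1/2::real" k] by linarith
  define D where "D k \<zeta> = Re (poly (P k) \<zeta>) - w \<zeta>" for k \<zeta>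
  have Dm [measurable]: "D k \<in> borel_measurable circle_measure" for k
    unfolding D_def by measurable
  have Db: "\<bar>D k z\<bar> \<le> 2 * B + 1" if "z \<in> unit_circle" for k z
    using Pb[OF that, of k] wb[OF that] unfolding D_def by linarith
  have iD: "integrable circle_measure (\<lambda>\<zeta>. \<bar>D k \<zeta>\<bar>)"
    "integrable circle_measure (\<lambda>\<zeta>. (D k \<zeta>)\<^sup>2)" for k
  proof -
    show "integrable circle_measure (\<lambda>\<zeta>. \<bar>D k \<zeta>\<bar>)"
      by (rule integrable_circle_bounded[where B = "2 * B + 1"]) (auto intro!: AE_I2 Db)
    have "(D k z)\<^sup>2 \<le> (2 * B + 1)\<^sup>2" if "z \<in> unit_circle" for z
      using Db[OF that, of k] by (intro abs_le_square_iff[THEN iffD1]) linarith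
    then show "integrable circle_measure (\<lambda>\<zeta>. (D k \<zeta>)\<^sup>2)"
      by (intro integrable_circle_bounded[where B = "(2 * B + 1)\<^sup>2"]) (auto intro!: AE_I2)
  qed
  have iW: "integrable circle_measure (\<lambda>\<zeta>. (W n \<zeta> - w \<zeta>)\<^sup>2)" for n
    by (rule integrable_circle_bounded[where B = "(2 * B)\<^sup>2"]) (use dist in \<open>auto intro!: AE_I2\<close>)
  have sq: "(a + b)\<^sup>2 \<le> 2 * a\<^sup>2 + 2 * b\<^sup>2" for a b :: real
    using sum_squares_bound[of a b] by (simp add: power2_sum)
  \<comment> \<open>The distance from \<open>w\<close> to \<open>W (N k)\<close> and the distance from there to \<open>Re (P k)\<close> contribute equal shares.\<close>
  have D2: "(LINT \<zeta>|circle_measure. (D k \<zeta>)\<^sup>2) \<le> 4 * (1/4) ^ k" for k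
  proof -
    have "(LINT \<zeta>|circle_measure. (D k \<zeta>)\<^sup>2) \<le>
        (LINT \<zeta>|circle_measure. 2 * (W (N k) \<zeta> - w \<zeta>)\<^sup>2 + 2 * (1/4) ^ k)"
    proof (rule integral_mono_AE)
      have "(D k z)\<^sup>2 \<le> 2 * (W (N k) z - w z)\<^sup>2 + 2 * (1/4) ^ k" if z: "z \<in> unit_circle" for z
      proof -
        have "(Re (poly (P k) z) - W (N k) z)\<^sup>2 \<le> ((1/2) ^ k)\<^sup>2"
          using P(2)[OF z, of k] by (intro abs_le_square_iff[THEN iffD1]) simp
        also have "((1/2) ^ k)\<^sup>2 = (1/4 :: real) ^ k"
          by (simp add: power2_eq_square flip: power_mult_distrib)
        finally show ?thesis
          using sq[of "W (N k) z - w z" "Re (poly (P k) z) - W (N k) z"] by (simp add: D_def)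
      qed
      then show "AE \<zeta> in circle_measure. (D k \<zeta>)\<^sup>2 \<le> 2 * (W (N k) \<zeta> - w \<zeta>)\<^sup>2 + 2 * (1/4) ^ k"
        by (intro AE_I2) simp
    qed (use iD iW in auto)
    also have "\<dots> = 2 * (LINT \<zeta>|circle_measure. (W (N k) \<zeta> - w \<zeta>)\<^sup>2) + 2 * (1/4) ^ k"
      using iW by (simp add: circle_measure.prob_space del: space_circle_measure)
    also have "\<dots> \<le> 4 * (1/4) ^ k" using N[of k] by simp
    finally show ?thesis .
  qed
  have quarter: "(c * (1/2) ^ k)\<^sup>2 = c\<^sup>2 * (1/4) ^ k" for c :: real and k :: nat
    by (simp add: power_mult_distrib power2_eq_square flip: power_mult_distrib)
  have D1: "(LINT \<zeta>|circle_measure. \<bar>D k \<zeta>\<bar>) \<le> 2 * (1/2) ^ k" for k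
    by (rule L1_le_of_L2_le) (use D2[of k] iD in \<open>auto simp: quarter\<close>)
  have geo: "summable (\<lambda>k. c * (1/2) ^ k)" for c :: real
    by (intro summable_mult summable_geometric) simp
  have "AE \<zeta> in circle_measure. summable (\<lambda>k. \<bar>D k \<zeta>\<bar>)"
    by (intro AE_summable_of_summable_integrals iD summable_comparison_test'[OF geo[of 2], of 0])
      (use D1 in auto)
  then have Re_lim: "AE \<zeta> in circle_measure. (\<lambda>k. Re (poly (P k) \<zeta>)) \<longlonglongrightarrow> w \<zeta>"
  proof eventually_elim
    case (elim \<zeta>)
    then have "(\<lambda>k. D k \<zeta>) \<longlonglongrightarrow> 0"
      using summable_LIMSEQ_zero tendsto_rabs_zero_iff by blast
    then show ?case by (simp add: D_def LIM_zero_iff)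
  qed
  define Q where "Q k = P (Suc k) - P k" for k
  have iQ: "integrable circle_measure (\<lambda>\<zeta>. cmod (poly (Q k) \<zeta>))"
    "integrable circle_measure (\<lambda>\<zeta>. (cmod (poly (Q k) \<zeta>))\<^sup>2)"
    "integrable circle_measure (\<lambda>\<zeta>. (Re (poly (Q k) \<zeta>))\<^sup>2)"
    "integrable circle_measure (\<lambda>\<zeta>. (Im (poly (Q k) \<zeta>))\<^sup>2)" for k
    by (intro integrable_circle_continuous continuous_intros)+
  \<comment> \<open>The real part contributes at most \<open>16 * (1/4)\<^sup>k\<close>, and the imaginary part no more than that; \<open>32 \<le> 6\<^sup>2\<close>.\<close>
  have Q2: "(LINT \<zeta>|circle_measure. (cmod (poly (Q k) \<zeta>))\<^sup>2) \<le> (6 * (1/2) ^ k)\<^sup>2" for k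
  proof -
    have pos: "0 < (1/4 :: real) ^ k" by simp
    have "(LINT \<zeta>|circle_measure. (Re (poly (Q k) \<zeta>))\<^sup>2) \<le>
        (LINT \<zeta>|circle_measure. 2 * (D (Suc k) \<zeta>)\<^sup>2 + 2 * (D k \<zeta>)\<^sup>2)"
    proof (rule integral_mono)
      show "(Re (poly (Q k) \<zeta>))\<^sup>2 \<le> 2 * (D (Suc k) \<zeta>)\<^sup>2 + 2 * (D k \<zeta>)\<^sup>2" for \<zeta>
        using sq[of "D (Suc k) \<zeta>" "- D k \<zeta>"] by (simp add: Q_def D_def power2_commute[of "w \<zeta>"])
    qed (use iD iQ in auto)
    also have "\<dots> = 2 * (LINT \<zeta>|circle_measure. (D (Suc k) \<zeta>)\<^sup>2) + 2 * (LINT \<zeta>|circle_measure. (D k \<zeta>)\<^sup>2)"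
      using iD by simp
    also have "\<dots> \<le> 16 * (1/4) ^ k"
      using D2[of k] D2[of "Suc k"] pos unfolding power_Suc by linarith
    finally have Re: "(LINT \<zeta>|circle_measure. (Re (poly (Q k) \<zeta>))\<^sup>2) \<le> 16 * (1/4) ^ k" .
    have "(LINT \<zeta>|circle_measure. (Im (poly (Q k) \<zeta>))\<^sup>2) \<le> (LINT \<zeta>|circle_measure. (Re (poly (Q k) \<zeta>))\<^sup>2)"
      by (rule conjugate_L2_bound) (auto simp: Q_def P(1) intro!: holomorphic_intros)
    moreover have "(LINT \<zeta>|circle_measure. (cmod (poly (Q k) \<zeta>))\<^sup>2) =
        (LINT \<zeta>|circle_measure. (Re (poly (Q k) \<zeta>))\<^sup>2) + (LINT \<zeta>|circle_measure. (Im (poly (Q k) \<zeta>))\<^sup>2)"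
      unfolding cmod_power2 using iQ by simp
    moreover have "(6 * (1/2) ^ k)\<^sup>2 = 36 * (1/4 :: real) ^ k"
      by (simp add: quarter)
    ultimately show ?thesis
      using Re pos by linarith
  qed
  have Q1: "(LINT \<zeta>|circle_measure. cmod (poly (Q k) \<zeta>)) \<le> 6 * (1/2) ^ k" for k
    using L1_le_of_L2_le[of "\<lambda>\<zeta>. cmod (poly (Q k) \<zeta>)" "6 * (1/2) ^ k"] Q2[of k] iQ by simp
  have "AE \<zeta> in circle_measure. summable (\<lambda>k. cmod (poly (Q k) \<zeta>))"
    by (intro AE_summable_of_summable_integrals iQ summable_comparison_test'[OF geo[of 6], of 0])
      (use Q1 in auto)
  then have P_conv: "AE \<zeta> in circle_measure. convergent (\<lambda>k. poly (P k) \<zeta>)"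
  proof eventually_elim
    case (elim \<zeta>)
    then have "summable (\<lambda>k. poly (P (Suc k)) \<zeta> - poly (P k) \<zeta>)"
      using summable_norm_cancel[OF elim] by (simp add: Q_def)
    then have "convergent (\<lambda>n. poly (P n) \<zeta> - poly (P 0) \<zeta>)"
      unfolding summable_iff_convergent sum_lessThan_telescope[of "\<lambda>k. poly (P k) \<zeta>"] .
    then have "convergent (\<lambda>n. (poly (P n) \<zeta> - poly (P 0) \<zeta>) + poly (P 0) \<zeta>)"
      by (rule convergent_add) (rule convergent_const)
    then show ?case by simp
  qed
  define G where "G \<zeta> = lim (\<lambda>k. exp (poly (P k) \<zeta>))" for \<zeta>
  have Gm [measurable]: "G \<in> borel_measurable circle_measure"
    unfolding G_def by measurable
  have G: "AE \<zeta> in circle_measure. (\<lambda>k. exp (poly (P k) \<zeta>)) \<longlonglongrightarrow> G \<zeta> \<and> cmod (G \<zeta>) = exp (w \<zeta>)"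
    using P_conv Re_lim
  proof eventually_elim
    case (elim \<zeta>)
    then obtain L where L: "(\<lambda>k. poly (P k) \<zeta>) \<longlonglongrightarrow> L" by (auto simp: convergent_def)
    have e: "(\<lambda>k. exp (poly (P k) \<zeta>)) \<longlonglongrightarrow> exp L" by (intro tendsto_exp L)
    then have "G \<zeta> = exp L" unfolding G_def by (rule limI)
    moreover have "Re L = w \<zeta>"
      using tendsto_Re[OF L] elim(2) by (rule LIMSEQ_unique)
    ultimately show ?case using e by simp
  qed
  have Gb: "ess_bounded G"
  proof (rule ess_boundedI[OF Gm])
    show "AE \<zeta> in circle_measure. cmod (G \<zeta>) \<le> exp B"
      using G AE_space by eventually_elim (use wb in \<open>fastforce simp: abs_le_iff\<close>)
  qed
  show thesis
  proof (rule that[of "abs_Linf G"])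
    show "AE \<zeta> in circle_measure. cmod (rep_Linf (abs_Linf G) \<zeta>) = exp (w \<zeta>)"
      using AE_rep_abs[OF Gb] G by eventually_elim simp
    have "fourier_coeff (abs_Linf G) k = 0" if neg: "k < 0" for k
    proof -
      obtain j where j: "k = - int j" "0 < j"
        using neg that[of "nat (- k)"] by auto
      have pow: "cnj z powi k = z ^ j" if "z \<in> unit_circle" for z
        using that by (simp add: cnj_powi_unit j)
      have int_lim: "(\<lambda>n. LINT \<zeta>|circle_measure. \<zeta> ^ j * exp (poly (P n) \<zeta>)) \<longlonglongrightarrow>
          (LINT \<zeta>|circle_measure. \<zeta> ^ j * G \<zeta>)"
      proof (rule integral_dominated_convergence[where w = "\<lambda>_. exp (B + 1)"])
        show "AE \<zeta> in circle_measure. (\<lambda>n. \<zeta> ^ j * exp (poly (P n) \<zeta>)) \<longlonglongrightarrow> \<zeta> ^ j * G \<zeta>"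
          using G by eventually_elim (auto intro: tendsto_mult_left)
        show "AE \<zeta> in circle_measure. norm (\<zeta> ^ j * exp (poly (P n) \<zeta>)) \<le> exp (B + 1)" for n
          using Pb[of _ n] by (intro AE_I2) (auto simp: norm_mult norm_power abs_le_iff)
        show "(\<lambda>\<zeta>. \<zeta> ^ j * G \<zeta>) \<in> borel_measurable circle_measure"
          by (intro borel_measurable_times Gm borel_measurable_circle_continuous continuous_intros)
        show "(\<lambda>\<zeta>. \<zeta> ^ j * exp (poly (P n) \<zeta>)) \<in> borel_measurable circle_measure" for n
          by (intro borel_measurable_circle_continuous continuous_intros)
      qed simp
      have "(LINT \<zeta>|circle_measure. \<zeta> ^ j * exp (poly (P n) \<zeta>)) = 0" for n
        by (subst circle_mean_value) (use j in \<open>auto intro!: holomorphic_intros\<close>)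
      then have "(LINT \<zeta>|circle_measure. \<zeta> ^ j * G \<zeta>) = 0"
        using int_lim by (simp add: LIMSEQ_const_iff)
      moreover have "fourier_coeff (abs_Linf G) k = (LINT \<zeta>|circle_measure. \<zeta> ^ j * G \<zeta>)"
        unfolding fourier_coeff_rep
      proof (rule integral_cong_AE)
        show "AE \<zeta> in circle_measure. cnj \<zeta> powi k * rep_Linf (abs_Linf G) \<zeta> = \<zeta> ^ j * G \<zeta>"
          using AE_rep_abs[OF Gb] AE_space by eventually_elim (simp add: pow)
        show "(\<lambda>\<zeta>. \<zeta> ^ j * G \<zeta>) \<in> borel_measurable circle_measure"
          by (intro borel_measurable_times Gm borel_measurable_circle_continuous continuous_intros)
      qed measurable
      ultimately show ?thesis by simp
    qed
    then show "abs_Linf G \<in> Hinf" by (simp add: Hinf_def)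
  qed
qed

text \<open>The continuous functions \<open>ln r * min 1 (n * infdist \<zeta> K)\<close> converge to \<open>0\<close> on \<open>K\<close> and
  \<open>ln r\<close> off \<open>K\<close>; closedness of \<open>K\<close> makes the distance positive off \<open>K\<close>.\<close>

lemma two_valued_modulus:
  assumes K: "closed K" "K \<noteq> {}" and "0 < r"
  obtains F where "F \<in> Hinf"
    "AE \<zeta> in circle_measure. cmod (rep_Linf F \<zeta>) = (if \<zeta> \<in> K then 1 else r)"
proof -
  define W where "W n \<zeta> = ln r * min 1 (real n * infdist \<zeta> K)" for n \<zeta>
  define w where "w \<zeta> = (if \<zeta> \<in> K then 0 else ln r)" for \<zeta>
  have "(\<lambda>n. W n z) \<longlonglongrightarrow> w z" for z
  proof (cases "z \<in> K")
    case True
    then show ?thesis by (simp add: W_def w_def)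
  next
    case False
    then have "0 < infdist z K"
      using K by (simp add: infdist_pos_not_in_closed)
    then obtain m where m: "1 < real m * infdist z K"
      using reals_Archimedean3 by blast
    have "eventually (\<lambda>n. W n z = w z) sequentially"
      using eventually_ge_at_top[of m]
    proof eventually_elim
      case (elim n)
      then have "real m * infdist z K \<le> real n * infdist z K"
        by (intro mult_right_mono infdist_nonneg) simp
      then show ?case using m False by (simp add: W_def w_def)
    qed
    then show ?thesis by (rule tendsto_eventually)
  qed
  moreover have "\<bar>W n z\<bar> \<le> \<bar>ln r\<bar>" for n z
    by (auto simp: W_def abs_mult infdist_nonneg intro!: mult_left_le)
  moreover have "continuous_on unit_circle (W n)" for n
    unfolding W_def by (intro continuous_intros)
  ultimately obtain F where F: "F \<in> Hinf" "AE \<zeta> in circle_measure. cmod (rep_Linf F \<zeta>) = exp (w \<zeta>)"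
    using outer_function[of W "\<bar>ln r\<bar>" w] by blast
  show thesis
    by (rule that[OF F(1)]) (use F(2) \<open>0 < r\<close> in \<open>auto simp: w_def elim!: eventually_mono\<close>)
qed


section \<open>Disjoint compact sets of positive measure\<close>

text \<open>A point has only countably many arguments.\<close>

lemma circle_point_null:
  shows "measure circle_measure {x} = 0"
proof (cases "x \<in> unit_circle")
  case True
  have "{t. cis t = x} \<subseteq> range (\<lambda>n::int. Arg x + 2 * pi * n)"
  proof
    fix t assume "t \<in> {t. cis t = x}"
    then have "cis t = cis (Arg x)"
      using True cis_Arg_unique by (auto simp: cis_Arg sgn_eq)
    then have "\<exists>n::int. t = Arg x + 2 * pi * n"
      by (subst sin_cos_eq_iff[symmetric]) (auto simp: cis.simps complex_eq_iff)
    then show "t \<in> range (\<lambda>n::int. Arg x + 2 * pi * n)" by auto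
  qed
  then have c: "countable {t. cis t = x}"
    by (rule countable_subset) auto
  then have null: "{t. cis t = x} \<in> null_sets lborel"
    by (rule countable_imp_null_set_lborel)
  have x: "{x} \<in> sets (restrict_space borel unit_circle)"
    using True by (simp add: sets_restrict_space_iff)
  have "emeasure circle_measure {x} = emeasure (uniform_measure lborel {0..2*pi}) {t. cis t = x}"
    unfolding circle_measure_def by (subst emeasure_distr[OF cis_measurable_circle x]) (simp add: vimage_def)
  also have "\<dots> = emeasure lborel ({0..2*pi} \<inter> {t. cis t = x}) / emeasure lborel {0..2*pi}"
    using null by (intro emeasure_uniform_measure) auto
  also have "emeasure lborel ({0..2*pi} \<inter> {t. cis t = x}) = 0"
    using null by (intro null_setsD1 null_set_Int1) auto
  finally show ?thesis by (simp add: measure_def)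
next
  case False
  then have "{x} \<notin> sets circle_measure"
    using sets.sets_into_space by fastforce
  then show ?thesis by (simp add: measure_notin_sets)
qed

lemma sets_circle_Int_borel:
  assumes "E \<in> sets circle_measure" "B \<in> sets borel"
  shows "E \<inter> B \<in> sets circle_measure"
proof -
  have "B \<inter> unit_circle \<in> sets circle_measure"
    using assms(2) by (auto simp: sets_circle_measure sets_restrict_space)
  then have "E \<inter> (B \<inter> unit_circle) \<in> sets circle_measure"
    using assms(1) by blast
  moreover have "E \<inter> (B \<inter> unit_circle) = E \<inter> B"
    using sets.sets_into_space[OF assms(1)] by auto
  ultimately show ?thesis by simp
qed

text \<open>By compactness, some point \<open>x\<close> of the circle is charged by \<open>E\<close> in each of its
  neighbourhoods. Since \<open>x\<close> itself is a null set, a small enough ball around \<open>x\<close> contains a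
  part of \<open>E\<close> that is neither null nor all of \<open>E\<close>.\<close>

lemma circle_split_positive_measure:
  assumes E: "E \<in> sets circle_measure" "0 < measure circle_measure E"
  obtains A where "A \<in> sets circle_measure" "A \<subseteq> E" "0 < measure circle_measure A"
    "0 < measure circle_measure (E - A)"
proof -
  have ball [measurable]: "E \<inter> ball x r \<in> sets circle_measure" for x r
    using E by (intro sets_circle_Int_borel) auto
  obtain x where x: "\<And>r. 0 < r \<Longrightarrow> 0 < measure circle_measure (E \<inter> ball x r)"
  proof (rule ccontr)
    assume "\<not> thesis"
    then have "\<exists>r>0. measure circle_measure (E \<inter> ball x r) = 0" for x
      using that by (metis measure_nonneg less_eq_real_def)
    then obtain r where r: "\<And>x. 0 < r x" "\<And>x. measure circle_measure (E \<inter> ball x (r x)) = 0"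
      by metis
    have "unit_circle \<subseteq> (\<Union>x\<in>unit_circle. ball x (r x))"
      using r(1) by auto
    then obtain D where D: "D \<subseteq> unit_circle" "finite D" "unit_circle \<subseteq> (\<Union>x\<in>D. ball x (r x))"
      by (rule compactE_image[OF compact_sphere, rotated]) auto
    have "measure circle_measure E \<le> measure circle_measure (\<Union>x\<in>D. E \<inter> ball x (r x))"
      using D sets.sets_into_space[OF E(1)]
      by (intro circle_measure.finite_measure_mono sets.finite_UN ball) auto
    also have "\<dots> \<le> (\<Sum>x\<in>D. measure circle_measure (E \<inter> ball x (r x)))"
      using D by (intro measure_UNION_le) auto
    also have "\<dots> = 0" by (simp add: r)
    finally show False using E(2) by simp
  qed
  define B where "B n = E \<inter> ball x (1 / real (Suc n))" for n
  have "(\<lambda>n. measure circle_measure (B n)) \<longlonglongrightarrow> measure circle_measure (\<Inter>n. B n)"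
  proof (rule circle_measure.finite_Lim_measure_decseq)
    show "range B \<subseteq> sets circle_measure" by (auto simp: B_def)
    show "decseq B"
      unfolding B_def decseq_def by (intro allI impI Int_mono order_refl subset_ball frac_le) auto
  qed
  moreover have "(\<Inter>n. B n) \<subseteq> {x}"
  proof
    fix y assume y: "y \<in> (\<Inter>n. B n)"
    have "dist x y = 0"
    proof (rule ccontr)
      assume "dist x y \<noteq> 0"
      then obtain n where "1 / real (Suc n) < dist x y"
        by (metis inverse_eq_divide reals_Archimedean zero_less_dist_iff dist_eq_0_iff)
      moreover have "y \<in> B n" using y by blast
      ultimately show False by (simp add: B_def)
    qed
    then show "y \<in> {x}" by simp
  qed
  then have "measure circle_measure (\<Inter>n. B n) = 0"
    using circle_point_null[of x] measure_empty by (auto simp: subset_singleton_iff)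
  ultimately have "eventually (\<lambda>n. measure circle_measure (B n) < measure circle_measure E) sequentially"
    using E(2) by (intro order_tendstoD(2)) auto
  then obtain n where n: "measure circle_measure (B n) < measure circle_measure E"
    by (auto simp: eventually_sequentially)
  show thesis
  proof (rule that[of "B n"])
    show "0 < measure circle_measure (B n)"
      using x[of "1 / real (Suc n)"] by (simp add: B_def)
    have "measure circle_measure (E - B n) = measure circle_measure E - measure circle_measure (B n)"
      using E by (intro circle_measure.finite_measure_Diff) (auto simp: B_def)
    then show "0 < measure circle_measure (E - B n)" using n by simp
  qed (auto simp: B_def)
qed

text \<open>Inner regularity, after pushing the measure forward to the Borel sets of the plane.\<close>

lemma circle_compact_subset_positive_measure:
  assumes E: "E \<in> sets circle_measure" "0 < measure circle_measure E"
  obtains K where "K \<subseteq> E" "compact K" "K \<in> sets circle_measure" "0 < measure circle_measure K"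
proof -
  have E': "E \<in> sets borel" "E \<subseteq> unit_circle"
    using E(1) sets.sets_into_space[OF E(1)]
    by (auto simp: sets_circle_measure sets_restrict_space_iff)
  have id: "(\<lambda>x. x) \<in> circle_measure \<rightarrow>\<^sub>M (borel :: complex measure)"
    by (rule borel_measurable_circle_continuous) (rule continuous_intros)
  define M where "M = distr circle_measure (borel :: complex measure) (\<lambda>x. x)"
  interpret M: prob_space M
    unfolding M_def by (rule circle_measure.prob_space_distr[OF id])
  have M: "emeasure M A = emeasure circle_measure A" if "A \<in> sets borel" "A \<subseteq> unit_circle" for A
    unfolding M_def using that by (subst emeasure_distr[OF id]) (auto simp: Int_absorb2)
  have "emeasure M E = (SUP K \<in> {K. K \<subseteq> E \<and> compact K}. emeasure M K)"
    by (rule inner_regular) (use E' M.emeasure_space_1 in \<open>simp_all add: M_def\<close>)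
  moreover have "0 < emeasure M E"
    using M[OF E'] E(2) by (simp add: circle_measure.emeasure_eq_measure)
  ultimately obtain K where K: "K \<subseteq> E" "compact K" "0 < emeasure M K"
    by (auto simp: less_SUP_iff)
  have "K \<in> sets borel" using K(2) by (simp add: borel_compact)
  then have "emeasure M K = emeasure circle_measure K" "K \<in> sets circle_measure"
    using K E' by (auto intro!: M simp: sets_circle_measure sets_restrict_space_iff)
  then show thesis
    using K that by (simp add: circle_measure.emeasure_eq_measure)
qed

lemma circle_disjoint_compact_subsets:
  assumes E: "E \<in> sets circle_measure" "0 < measure circle_measure E"
  shows "\<exists>K :: nat \<Rightarrow> complex set. (\<forall>i\<le>n. K i \<subseteq> E \<and> compact (K i) \<and> K i \<in> sets circle_measure \<and>
      0 < measure circle_measure (K i)) \<and> disjoint_family_on K {..n}"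
  using E
proof (induction n arbitrary: E)
  case 0
  obtain K where "K \<subseteq> E" "compact K" "K \<in> sets circle_measure" "0 < measure circle_measure K"
    using circle_compact_subset_positive_measure[OF 0] by blast
  then show ?case
    by (intro exI[of _ "\<lambda>_. K"]) (auto simp: disjoint_family_on_def)
next
  case (Suc n)
  obtain A where A: "A \<in> sets circle_measure" "A \<subseteq> E" "0 < measure circle_measure A"
    "0 < measure circle_measure (E - A)"
    using circle_split_positive_measure[OF Suc.prems] by blast
  obtain K where K: "\<forall>i\<le>n. K i \<subseteq> A \<and> compact (K i) \<and> K i \<in> sets circle_measure \<and>
    0 < measure circle_measure (K i)" "disjoint_family_on K {..n}"
    using Suc.IH[OF A(1,3)] by blast
  have "E - A \<in> sets circle_measure" using A Suc.prems by auto
  then obtain L where L: "L \<subseteq> E - A" "compact L" "L \<in> sets circle_measure" "0 < measure circle_measure L"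
    using circle_compact_subset_positive_measure[OF _ A(4)] by blast
  have "disjoint_family_on (K(Suc n := L)) {..Suc n}"
    using K L unfolding disjoint_family_on_def by (auto simp: le_Suc_eq) blast+
  moreover have "\<forall>i\<le>Suc n. (K(Suc n := L)) i \<subseteq> E \<and> compact ((K(Suc n := L)) i) \<and>
      (K(Suc n := L)) i \<in> sets circle_measure \<and> 0 < measure circle_measure ((K(Suc n := L)) i)"
    using K L A by (auto simp: le_Suc_eq)
  ultimately show ?case by blast
qed

text \<open>Among many disjoint sets of total measure at most \<open>1\<close>, one is small.\<close>

lemma circle_small_compact_set:
  assumes "0 < e"
  obtains K where "compact K" "K \<in> sets circle_measure" "0 < measure circle_measure K"
    "measure circle_measure K \<le> e"
proof -
  obtain n where n: "1 / real (Suc n) < e"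
    using assms by (metis inverse_eq_divide reals_Archimedean)
  have circle: "unit_circle \<in> sets circle_measure" "0 < measure circle_measure unit_circle"
    using sets.top[of circle_measure] circle_measure.prob_space by auto
  obtain K :: "nat \<Rightarrow> complex set" where K: "\<forall>i\<le>n. K i \<subseteq> unit_circle \<and> compact (K i) \<and>
      K i \<in> sets circle_measure \<and> 0 < measure circle_measure (K i)" "disjoint_family_on K {..n}"
    using circle_disjoint_compact_subsets[OF circle, of n] by blast
  have "\<exists>i\<le>n. measure circle_measure (K i) \<le> e"
  proof (rule ccontr)
    assume "\<not> ?thesis"
    then have "(\<Sum>i\<le>n. e) \<le> (\<Sum>i\<le>n. measure circle_measure (K i))"
      by (intro sum_mono) auto
    also have "\<dots> = measure circle_measure (\<Union>i\<le>n. K i)"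
      using K by (intro circle_measure.finite_measure_finite_Union[symmetric]) auto
    also have "\<dots> \<le> 1" by (rule circle_measure.prob_le_1)
    finally show False using n by (simp add: field_simps)
  qed
  then obtain i where "i \<le> n" "measure circle_measure (K i) \<le> e" by blast
  then show thesis using K by (intro that[of "K i"]) auto
qed


section \<open>Underdetermined linear systems\<close>

text \<open>Gaussian elimination: one equation is used to express one unknown, and the remaining
  ones are solved by induction.\<close>

lemma homogeneous_system_nontrivial_solution:
  fixes a :: "'p \<Rightarrow> 'i \<Rightarrow> 'k::field"
  assumes "finite \<Phi>" "finite I" "card \<Phi> < card I"
  shows "\<exists>c. (\<exists>i\<in>I. c i \<noteq> 0) \<and> (\<forall>\<phi>\<in>\<Phi>. (\<Sum>i\<in>I. c i * a \<phi> i) = 0)"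
  using assms
proof (induction \<Phi> arbitrary: I a rule: finite_induct)
  case empty
  then have "I \<noteq> {}" by auto
  then show ?case by (intro exI[of _ "\<lambda>_. 1"]) auto
next
  case (insert \<phi> \<Phi>)
  show ?case
  proof (cases "\<forall>i\<in>I. a \<phi> i = 0")
    case True
    obtain c where "\<exists>i\<in>I. c i \<noteq> 0" "\<forall>\<psi>\<in>\<Phi>. (\<Sum>i\<in>I. c i * a \<psi> i) = 0"
      using insert.IH[of I a] insert.prems insert.hyps by (auto dest: Suc_lessD)
    then show ?thesis using True by (intro exI[of _ c]) auto
  next
    case False
    then obtain i\<^sub>0 where i0: "i\<^sub>0 \<in> I" "a \<phi> i\<^sub>0 \<noteq> 0" by blast
    \<comment> \<open>The coefficients after eliminating the unknown \<open>i\<^sub>0\<close> by means of the equation \<open>\<phi>\<close>.\<close>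
    define b where "b \<psi> i = a \<psi> i - a \<psi> i\<^sub>0 * a \<phi> i / a \<phi> i\<^sub>0" for \<psi> i
    have "card \<Phi> < card (I - {i\<^sub>0})"
      using insert i0 by (simp add: card_Diff_singleton)
    then obtain c where c: "\<exists>i\<in>I - {i\<^sub>0}. c i \<noteq> 0" "\<forall>\<psi>\<in>\<Phi>. (\<Sum>i\<in>I - {i\<^sub>0}. c i * b \<psi> i) = 0"
      using insert.IH[of "I - {i\<^sub>0}" b] insert.prems by auto
    define s where "s = (\<Sum>i\<in>I - {i\<^sub>0}. c i * a \<phi> i) / a \<phi> i\<^sub>0"
    define d where "d = c(i\<^sub>0 := - s)"
    have d: "(\<Sum>i\<in>I. d i * a \<psi> i) = (\<Sum>i\<in>I - {i\<^sub>0}. c i * a \<psi> i) - s * a \<psi> i\<^sub>0" for \<psi>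
    proof -
      have "(\<Sum>i\<in>I - {i\<^sub>0}. d i * a \<psi> i) = (\<Sum>i\<in>I - {i\<^sub>0}. c i * a \<psi> i)"
        by (rule sum.cong) (auto simp: d_def)
      then show ?thesis
        using insert i0 by (subst sum.remove[of I i\<^sub>0]) (auto simp: d_def)
    qed
    have b: "(\<Sum>i\<in>I - {i\<^sub>0}. c i * b \<psi> i) = (\<Sum>i\<in>I - {i\<^sub>0}. c i * a \<psi> i) - s * a \<psi> i\<^sub>0" for \<psi>
      by (simp add: b_def s_def right_diff_distrib sum_subtractf sum_distrib_left sum_distrib_right sum_divide_distrib mult_ac)
    have "(\<Sum>i\<in>I. d i * a \<psi> i) = 0" if "\<psi> \<in> insert \<phi> \<Phi>" for \<psi>
      using that c(2) i0 by (auto simp: d simp flip: b) (simp add: b_def)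
    moreover have "\<exists>i\<in>I. d i \<noteq> 0" using c(1) by (auto simp: d_def)
    ultimately show ?thesis by blast
  qed
qed

lemma normalized_homogeneous_solution:
  fixes a :: "'p \<Rightarrow> nat \<Rightarrow> complex"
  assumes "finite \<Phi>" "card \<Phi> \<le> n"
  shows "\<exists>k c. k \<le> n \<and> cmod (c k) = 1 \<and> (\<forall>i\<le>n. cmod (c i) \<le> 1) \<and>
    (\<forall>\<phi>\<in>\<Phi>. (\<Sum>i\<le>n. c i * a \<phi> i) = 0)"
proof -
  obtain d where d: "\<exists>i\<in>{..n}. d i \<noteq> 0" "\<forall>\<phi>\<in>\<Phi>. (\<Sum>i\<le>n. d i * a \<phi> i) = 0"
    using homogeneous_system_nontrivial_solution[of \<Phi> "{..n}" a] assms by auto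
  obtain k where k: "k \<le> n" "\<And>i. i \<le> n \<Longrightarrow> cmod (d i) \<le> cmod (d k)"
  proof -
    have "Max ((\<lambda>i. cmod (d i)) ` {..n}) \<in> (\<lambda>i. cmod (d i)) ` {..n}"
      by (intro Max_in) auto
    then obtain k where k: "Max ((\<lambda>i. cmod (d i)) ` {..n}) = cmod (d k)" "k \<in> {..n}"
      by (rule imageE)
    then show thesis by (intro that[of k]) (auto simp flip: k(1))
  qed
  have pos: "0 < cmod (d k)"
    using d(1) k(2) by (metis atMost_iff less_le_trans zero_less_norm_iff)
  have "(\<Sum>i\<le>n. d i / d k * a \<phi> i) = (\<Sum>i\<le>n. d i * a \<phi> i) / d k" for \<phi>
    by (simp add: sum_divide_distrib)
  then have "\<forall>\<phi>\<in>\<Phi>. (\<Sum>i\<le>n. d i / d k * a \<phi> i) = 0"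
    using d(2) by simp
  then show ?thesis
    using k pos by (intro exI[of _ k] exI[of _ "\<lambda>i. d i / d k"]) (simp add: norm_divide)
qed


section \<open>The lower bound\<close>

text \<open>Let \<open>n\<close> be the number of functionals and let \<open>K 0, \<dots>, K n\<close> be disjoint compact subsets
  of positive measure of the set where \<open>f\<close> is small. Take analytic functions \<open>F i\<close> with
  modulus \<open>1\<close> on \<open>K i\<close> and a tiny modulus \<open>r\<close> elsewhere. There are more of them than
  functionals, so some combination \<open>S\<close> with largest coefficient of modulus \<open>1\<close> is annihilated
  by all functionals. Its norm is at least \<open>1/2\<close>, since \<open>\<bar>S\<bar>\<close> is that large on the set \<open>K k\<close>
  belonging to the largest coefficient, while \<open>S\<close> is uniformly small off the union of the
  \<open>K i\<close>. After rescaling to norm \<open>1 - \<eta>\<close>, the perturbation \<open>y\<close> fits under the unit bound where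
  \<open>\<bar>f\<bar> \<le> \<eta>\<close> and is below \<open>\<delta>\<close> everywhere else.\<close>

lemma admissible_ge:
  assumes \<Phi>: "\<Phi> \<subseteq> Hinf_dual" "finite \<Phi>" and f: "f \<in> small_set_class \<Phi> \<eta> \<gamma>"
    and \<eta>: "0 < \<eta>" "\<eta> < 1" and \<gamma>: "0 < \<gamma>" and adm: "admissible (Hinf_sub \<Phi>) f \<epsilon>"
  shows "1 - \<eta> \<le> \<epsilon>"
proof -
  obtain \<delta> where \<delta>: "0 < \<delta>"
    "\<And>y. y \<in> Hinf_sub \<Phi> \<Longrightarrow> max (norm (f + y)) (norm (f - y)) < 1 + \<delta> \<Longrightarrow> norm y < \<epsilon>"
    using adm unfolding admissible_def by blast
  define n where "n = card \<Phi>"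
  have nf: "norm f = 1" and mE: "\<gamma> \<le> measure circle_measure (sublevel \<eta> f)"
    using f by (auto simp: small_set_class_def)
  have "{\<zeta> \<in> space circle_measure. cmod (rep_Linf f \<zeta>) \<le> \<eta>} \<in> sets circle_measure"
    by measurable
  then have E: "sublevel \<eta> f \<in> sets circle_measure" by (simp add: sublevel_def)
  have E_pos: "0 < measure circle_measure (sublevel \<eta> f)" using mE \<gamma> by linarith
  obtain K :: "nat \<Rightarrow> complex set" where K_all: "\<forall>i\<le>n. K i \<subseteq> sublevel \<eta> f \<and> compact (K i) \<and>
      K i \<in> sets circle_measure \<and> 0 < measure circle_measure (K i)" and disj: "disjoint_family_on K {..n}"
    using circle_disjoint_compact_subsets[OF E E_pos, of n] by blast
  have K: "K i \<subseteq> sublevel \<eta> f" "compact (K i)" "K i \<in> sets circle_measure"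
    "0 < measure circle_measure (K i)" if "i \<le> n" for i
    using K_all that by auto
  \<comment> \<open>Chosen so that \<open>n + 1\<close> tails of size \<open>r\<close> add up to at most \<open>1/2\<close> and at most \<open>\<delta>/2\<close>.\<close>
  define r where "r = min 1 \<delta> / (2 * real (Suc n))"
  have r: "0 < r" "real (Suc n) * r = min 1 \<delta> / 2"
    using \<delta>(1) by (simp_all add: r_def del: of_nat_Suc)
  have "\<exists>F. F \<in> Hinf \<and> (AE \<zeta> in circle_measure. cmod (rep_Linf F \<zeta>) = (if \<zeta> \<in> K i then 1 else r))"
    if i: "i \<le> n" for i
  proof -
    have "K i \<noteq> {}" using K(4)[OF i] by auto
    then show ?thesis
      by (rule two_valued_modulus[OF compact_imp_closed[OF K(2)[OF i]] _ r(1)]) blast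
  qed
  then have "\<exists>F. \<forall>i\<in>{..n}. F i \<in> Hinf \<and>
      (AE \<zeta> in circle_measure. cmod (rep_Linf (F i) \<zeta>) = (if \<zeta> \<in> K i then 1 else r))"
    by (intro bchoice) simp
  then obtain F where F: "\<And>i. i \<le> n \<Longrightarrow> F i \<in> Hinf"
    "\<And>i. i \<le> n \<Longrightarrow> AE \<zeta> in circle_measure. cmod (rep_Linf (F i) \<zeta>) = (if \<zeta> \<in> K i then 1 else r)"
    by blast
  obtain k c where k: "k \<le> n" "cmod (c k) = 1" and c: "\<And>i. i \<le> n \<Longrightarrow> cmod (c i) \<le> 1"
    "\<And>\<phi>. \<phi> \<in> \<Phi> \<Longrightarrow> (\<Sum>i\<le>n. c i * \<phi> (F i)) = 0"
    using normalized_homogeneous_solution[OF \<Phi>(2), of n "\<lambda>\<phi> i. \<phi> (F i)"] n_def by auto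
  define S where "S = (\<Sum>i\<le>n. cscale (c i) (F i))"
  have S_Hinf: "S \<in> Hinf"
    unfolding S_def by (intro Hinf_sum Hinf_cscale F) simp
  have S_ker: "\<phi> S = 0" if "\<phi> \<in> \<Phi>" for \<phi>
  proof -
    have "\<phi> S = (\<Sum>i\<le>n. \<phi> (cscale (c i) (F i)))"
      unfolding S_def using that \<Phi>(1) by (intro Hinf_dual_sum Hinf_cscale F) auto
    also have "\<dots> = (\<Sum>i\<le>n. c i * \<phi> (F i))"
      using that \<Phi>(1) F(1) by (intro sum.cong) (auto simp: Hinf_dual_def)
    finally show ?thesis using c(2)[OF that] by simp
  qed
  have "AE \<zeta> in circle_measure. \<forall>i\<in>{..n}. rep_Linf (cscale (c i) (F i)) \<zeta> = c i * rep_Linf (F i) \<zeta>"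
    by (intro AE_finite_allI AE_rep_cscale) simp
  then have S_rep: "AE \<zeta> in circle_measure. rep_Linf S \<zeta> = (\<Sum>i\<le>n. c i * rep_Linf (F i) \<zeta>)"
    using AE_rep_sum[OF finite_atMost, of "\<lambda>i. cscale (c i) (F i)" n]
    unfolding S_def by eventually_elim simp
  have F_all: "AE \<zeta> in circle_measure. \<forall>i\<in>{..n}. cmod (rep_Linf (F i) \<zeta>) = (if \<zeta> \<in> K i then 1 else r)"
    by (intro AE_finite_allI F) auto
  have off: "AE \<zeta> in circle_measure. \<zeta> \<notin> (\<Union>i\<le>n. K i) \<longrightarrow> cmod (rep_Linf S \<zeta>) \<le> min 1 \<delta> / 2"
    using S_rep F_all
  proof eventually_elim
    case (elim \<zeta>)
    show ?case
    proof
      assume \<zeta>: "\<zeta> \<notin> (\<Union>i\<le>n. K i)"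
      have "cmod (rep_Linf S \<zeta>) \<le> (\<Sum>i\<le>n. cmod (c i * rep_Linf (F i) \<zeta>))"
        unfolding elim(1) by (rule norm_sum)
      also have "\<dots> \<le> (\<Sum>i\<le>n. r)"
      proof (rule sum_mono)
        fix i assume i: "i \<in> {..n}"
        then have "cmod (rep_Linf (F i) \<zeta>) = r" using elim(2) \<zeta> by auto
        then show "cmod (c i * rep_Linf (F i) \<zeta>) \<le> r"
          using c(1)[of i] i r(1) by (simp add: norm_mult mult_left_le_one_le)
      qed
      also have "\<dots> = min 1 \<delta> / 2" using r(2) by simp
      finally show "cmod (rep_Linf S \<zeta>) \<le> min 1 \<delta> / 2" .
    qed
  qed
  have "AE \<zeta> in circle_measure. \<zeta> \<in> K k \<longrightarrow> 1 / 2 \<le> cmod (rep_Linf S \<zeta>)"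
    using S_rep F_all
  proof eventually_elim
    case (elim \<zeta>)
    show ?case
    proof
      assume \<zeta>: "\<zeta> \<in> K k"
      have "cmod (\<Sum>i\<in>{..n} - {k}. c i * rep_Linf (F i) \<zeta>) \<le> (\<Sum>i\<in>{..n} - {k}. cmod (c i * rep_Linf (F i) \<zeta>))"
        by (rule norm_sum)
      also have "\<dots> \<le> (\<Sum>i\<in>{..n} - {k}. r)"
      proof (rule sum_mono)
        fix i assume i: "i \<in> {..n} - {k}"
        then have "\<zeta> \<notin> K i"
          using disj \<zeta> k(1) unfolding disjoint_family_on_def by blast
        then have "cmod (rep_Linf (F i) \<zeta>) = r" using elim(2) i by auto
        then show "cmod (c i * rep_Linf (F i) \<zeta>) \<le> r"
          using c(1)[of i] i r(1) by (simp add: norm_mult mult_left_le_one_le)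
      qed
      also have "\<dots> \<le> (\<Sum>i\<le>n. r)"
        using r(1) by (intro sum_mono2) auto
      also have "\<dots> = min 1 \<delta> / 2" using r(2) by simp
      also have "\<dots> \<le> 1 / 2" by simp
      finally have rest: "cmod (\<Sum>i\<in>{..n} - {k}. c i * rep_Linf (F i) \<zeta>) \<le> 1 / 2" .
      have "rep_Linf S \<zeta> = c k * rep_Linf (F k) \<zeta> + (\<Sum>i\<in>{..n} - {k}. c i * rep_Linf (F i) \<zeta>)"
        unfolding elim(1) using k(1) by (intro sum.remove) auto
      moreover have "cmod (c k * rep_Linf (F k) \<zeta>) = 1"
        using elim(2) \<zeta> k by (simp add: norm_mult)
      ultimately show "1 / 2 \<le> cmod (rep_Linf S \<zeta>)"
        using rest norm_triangle_ineq4[of "rep_Linf S \<zeta>" "\<Sum>i\<in>{..n} - {k}. c i * rep_Linf (F i) \<zeta>"]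
        by simp
    qed
  qed
  then have S_norm: "1 / 2 \<le> norm S"
    using K(3,4) k(1) by (intro norm_Linf_ge) auto
  then have "norm S \<noteq> 0" by linarith
  define a where "a = (1 - \<eta>) / norm S"
  define y where "y = a *\<^sub>R S"
  have y_norm: "norm y = 1 - \<eta>"
    using \<open>norm S \<noteq> 0\<close> \<eta> by (simp add: y_def a_def)
  have y_eq: "y = cscale (of_real a) S" by (simp add: y_def scaleR_Linf_def)
  have "y \<in> Hinf_sub \<Phi>"
    unfolding Hinf_sub_def y_eq using \<Phi>(1) S_Hinf S_ker
    by (auto simp: Hinf_cscale Hinf_dual_def subset_iff)
  have a: "0 \<le> a" "a \<le> 2 * (1 - \<eta>)"
    using S_norm \<open>norm S \<noteq> 0\<close> \<eta> divide_left_mono[of "1 / 2" "norm S" "1 - \<eta>"] by (simp_all add: a_def)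
  have y_off: "AE \<zeta> in circle_measure. \<zeta> \<notin> (\<Union>i\<le>n. K i) \<longrightarrow> cmod (rep_Linf y \<zeta>) \<le> (1 - \<eta>) * \<delta>"
    using off AE_rep_cscale[of "of_real a" S]
  proof eventually_elim
    case (elim \<zeta>)
    show ?case
    proof
      assume "\<zeta> \<notin> (\<Union>i\<le>n. K i)"
      then have "cmod (rep_Linf S \<zeta>) \<le> \<delta> / 2" using elim(1) by simp
      then have "a * cmod (rep_Linf S \<zeta>) \<le> 2 * (1 - \<eta>) * (\<delta> / 2)"
        using a \<eta> by (intro mult_mono) auto
      also have "\<dots> = (1 - \<eta>) * \<delta>" by simp
      finally show "cmod (rep_Linf y \<zeta>) \<le> (1 - \<eta>) * \<delta>"
        using elim(2) a by (simp add: y_eq norm_mult)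
    qed
  qed
  have sum: "AE \<zeta> in circle_measure. cmod (rep_Linf f \<zeta>) + cmod (rep_Linf y \<zeta>) \<le> 1 + (1 - \<eta>) * \<delta>"
    using y_off AE_le_norm[of y] AE_le_norm[of f]
  proof eventually_elim
    case (elim \<zeta>)
    have p: "0 \<le> (1 - \<eta>) * \<delta>" using \<eta> \<delta>(1) by simp
    show ?case
    proof (cases "\<zeta> \<in> (\<Union>i\<le>n. K i)")
      case True
      then have "cmod (rep_Linf f \<zeta>) \<le> \<eta>" using K(1) by (auto simp: sublevel_def)
      then show ?thesis using elim(2) y_norm p by simp
    next
      case False
      then show ?thesis using elim nf by simp
    qed
  qed
  have "norm (f + y) \<le> 1 + (1 - \<eta>) * \<delta>"
    by (rule norm_Linf_le, use sum AE_rep_add[of f y] in eventually_elim)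
       (simp add: order_trans[OF norm_triangle_ineq])
  moreover have "norm (f - y) \<le> 1 + (1 - \<eta>) * \<delta>"
    by (rule norm_Linf_le, use sum AE_rep_diff[of f y] in eventually_elim)
       (simp add: order_trans[OF norm_triangle_ineq4])
  moreover have "(1 - \<eta>) * \<delta> < \<delta>" using \<eta> \<delta>(1) by simp
  ultimately have "norm y < \<epsilon>"
    using \<open>y \<in> Hinf_sub \<Phi>\<close> by (intro \<delta>(2)) auto
  then show ?thesis using y_norm by simp
qed

lemma eps_star_ge:
  assumes "0 < \<eta>" "\<eta> < 1" "0 < \<gamma>"
  shows "ereal (1 - \<eta>) \<le> eps_star N \<eta> \<gamma>"
  unfolding eps_star_def eps_def
proof (intro INF_greatest)
  fix \<Phi> f \<epsilon>
  assume "\<Phi> \<in> {\<Phi>. \<Phi> \<subseteq> Hinf_dual \<and> finite \<Phi> \<and> card \<Phi> = N}" "f \<in> small_set_class \<Phi> \<eta> \<gamma>"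
    "\<epsilon> \<in> {\<epsilon>. 0 < \<epsilon> \<and> admissible (Hinf_sub \<Phi>) f \<epsilon>}"
  then show "ereal (1 - \<eta>) \<le> ereal \<epsilon>"
    using admissible_ge[of \<Phi> f \<eta> \<gamma> \<epsilon>] assms by simp
qed


section \<open>The upper bound\<close>

text \<open>The parallelogram law at each point: if \<open>\<bar>f + y\<bar>\<close> and \<open>\<bar>f - y\<bar>\<close> are at most \<open>M\<close>, then
  \<open>\<bar>y\<bar>\<^sup>2 \<le> M\<^sup>2 - \<bar>f\<bar>\<^sup>2 \<le> M\<^sup>2 - \<eta>\<^sup>2\<close>. The choice of \<open>\<delta>\<close> makes \<open>(1 + \<delta>)\<^sup>2 - \<eta>\<^sup>2 = \<epsilon>\<^sup>2\<close>.\<close>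

lemma admissible_if_modulus_ge:
  assumes \<eta>: "0 < \<eta>" "\<eta> < 1" and f: "AE \<zeta> in circle_measure. \<eta> \<le> cmod (rep_Linf f \<zeta>)"
    and \<epsilon>: "sqrt (1 - \<eta>\<^sup>2) < \<epsilon>"
  shows "admissible X f \<epsilon>"
proof -
  have "0 \<le> sqrt (1 - \<eta>\<^sup>2)" using \<eta> by (simp add: power_le_one)
  then have \<epsilon>0: "0 < \<epsilon>" using \<epsilon> by (rule le_less_trans)
  have "(sqrt (1 - \<eta>\<^sup>2))\<^sup>2 < \<epsilon>\<^sup>2"
    by (rule power_strict_mono[OF \<epsilon>]) (use \<eta> in \<open>simp_all add: power_le_one\<close>)
  then have "1 - \<eta>\<^sup>2 < \<epsilon>\<^sup>2" using \<eta> by (simp add: power_le_one)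
  then have "1 < sqrt (\<epsilon>\<^sup>2 + \<eta>\<^sup>2)" by simp
  define \<delta> where "\<delta> = sqrt (\<epsilon>\<^sup>2 + \<eta>\<^sup>2) - 1"
  have "norm y < \<epsilon>" if "max (norm (f + y)) (norm (f - y)) < 1 + \<delta>" for y
  proof -
    define M where "M = max (norm (f + y)) (norm (f - y))"
    have M: "0 \<le> M" "M < sqrt (\<epsilon>\<^sup>2 + \<eta>\<^sup>2)"
      using that by (auto simp: M_def \<delta>_def le_max_iff_disj)
    have "AE \<zeta> in circle_measure. cmod (rep_Linf y \<zeta>) \<le> sqrt (M\<^sup>2 - \<eta>\<^sup>2)"
      using AE_rep_add[of f y] AE_rep_diff[of f y] AE_le_norm[of "f + y"] AE_le_norm[of "f - y"] f
    proof eventually_elim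
      case (elim \<zeta>)
      let ?f = "rep_Linf f \<zeta>" and ?y = "rep_Linf y \<zeta>"
      have "cmod (?f + ?y) \<le> M" "cmod (?f - ?y) \<le> M"
        using elim by (auto simp: M_def)
      then have "(cmod (?f + ?y))\<^sup>2 + (cmod (?f - ?y))\<^sup>2 \<le> M\<^sup>2 + M\<^sup>2"
        by (intro add_mono power_mono) auto
      moreover have "(cmod (?f + ?y))\<^sup>2 + (cmod (?f - ?y))\<^sup>2 = 2 * (cmod ?f)\<^sup>2 + 2 * (cmod ?y)\<^sup>2"
        unfolding cmod_power2 by (simp add: power2_eq_square algebra_simps)
      moreover have "\<eta>\<^sup>2 \<le> (cmod ?f)\<^sup>2"
        using elim \<eta> by (intro power_mono) auto
      ultimately have "(cmod ?y)\<^sup>2 \<le> M\<^sup>2 - \<eta>\<^sup>2" by linarith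
      then show ?case by (rule real_le_rsqrt)
    qed
    then have "norm y \<le> sqrt (M\<^sup>2 - \<eta>\<^sup>2)" by (rule norm_Linf_le)
    also have "M\<^sup>2 < (sqrt (\<epsilon>\<^sup>2 + \<eta>\<^sup>2))\<^sup>2"
      using M by (intro power_strict_mono) auto
    then have "sqrt (M\<^sup>2 - \<eta>\<^sup>2) < sqrt (\<epsilon>\<^sup>2)"
      by (intro real_sqrt_less_mono) simp
    also have "sqrt (\<epsilon>\<^sup>2) = \<epsilon>" using \<epsilon>0 by simp
    finally show ?thesis .
  qed
  moreover have "0 < \<delta>" using \<open>1 < sqrt (\<epsilon>\<^sup>2 + \<eta>\<^sup>2)\<close> by (simp add: \<delta>_def)
  ultimately show ?thesis unfolding admissible_def by blast
qed

text \<open>A function whose modulus is \<open>1\<close> on a small set of positive measure, which fixes its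
  norm, and \<open>\<eta>\<close> on the rest of the circle.\<close>

lemma two_valued_function_in_class:
  assumes \<eta>: "0 < \<eta>" "\<eta> < 1" and \<gamma>: "\<gamma> < 1"
  obtains f where "f \<in> Hinf" "norm f = 1" "AE \<zeta> in circle_measure. \<eta> \<le> cmod (rep_Linf f \<zeta>)"
    "\<gamma> \<le> measure circle_measure (sublevel \<eta> f)"
proof -
  obtain K where K: "compact K" "K \<in> sets circle_measure" "0 < measure circle_measure K"
    "measure circle_measure K \<le> 1 - \<gamma>"
    using circle_small_compact_set[of "1 - \<gamma>"] \<gamma> by auto
  have "K \<noteq> {}" using K(3) by auto
  then obtain f where f: "f \<in> Hinf"
    "AE \<zeta> in circle_measure. cmod (rep_Linf f \<zeta>) = (if \<zeta> \<in> K then 1 else \<eta>)"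
    using two_valued_modulus[OF compact_imp_closed[OF K(1)] _ \<eta>(1)] by blast
  have "norm f \<le> 1"
    by (rule norm_Linf_le, use f(2) in eventually_elim) (use \<eta> in auto)
  moreover have "1 \<le> norm f"
    by (rule norm_Linf_ge[OF K(2,3)], use f(2) in eventually_elim) auto
  moreover have "AE \<zeta> in circle_measure. \<eta> \<le> cmod (rep_Linf f \<zeta>)"
    using f(2) by eventually_elim (use \<eta> in auto)
  moreover have "\<gamma> \<le> measure circle_measure (sublevel \<eta> f)"
  proof -
    have "\<gamma> \<le> 1 - measure circle_measure K" using K(4) by simp
    also have "\<dots> = measure circle_measure (space circle_measure - K)"
      by (rule circle_measure.prob_compl[symmetric, OF K(2)])
    also have "\<dots> \<le> measure circle_measure (sublevel \<eta> f)"
    proof (rule circle_measure.finite_measure_mono_AE)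
      show "AE \<zeta> in circle_measure. \<zeta> \<in> space circle_measure - K \<longrightarrow> \<zeta> \<in> sublevel \<eta> f"
        using f(2) by eventually_elim (auto simp: sublevel_def)
      have "{\<zeta> \<in> space circle_measure. cmod (rep_Linf f \<zeta>) \<le> \<eta>} \<in> sets circle_measure"
        by measurable
      then show "sublevel \<eta> f \<in> sets circle_measure" by (simp add: sublevel_def)
    qed
    finally show ?thesis .
  qed
  ultimately show thesis by (intro that[OF f(1)]) auto
qed

lemma fourier_coeff_monomial:
  assumes "k \<le> int j"
  shows "fourier_coeff (abs_Linf (\<lambda>\<zeta>. \<zeta> ^ j)) k = (if k = int j then 1 else 0)"
proof -
  define d where "d = nat (int j - k)"
  have m: "(\<lambda>\<zeta>. \<zeta> ^ n) \<in> borel_measurable circle_measure" for n :: nat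
    by (intro borel_measurable_circle_continuous continuous_intros)
  have b: "ess_bounded (\<lambda>\<zeta>. \<zeta> ^ j)"
    using m by (rule ess_boundedI[where C = 1]) (auto intro!: AE_I2 simp: norm_power)
  have pow: "cnj z powi k * z ^ j = z ^ d" if "cmod z = 1" for z
  proof -
    have "z \<noteq> 0" using that by auto
    then have "z powi (- k) * z powi int j = z powi (- k + int j)"
      by (intro power_int_add[symmetric]) auto
    also have "- k + int j = int d" using assms by (simp add: d_def)
    finally show ?thesis using that by (simp add: cnj_powi_unit)
  qed
  have "fourier_coeff (abs_Linf (\<lambda>\<zeta>. \<zeta> ^ j)) k = (LINT \<zeta>|circle_measure. \<zeta> ^ d)"
    unfolding fourier_coeff_rep
  proof (rule integral_cong_AE)
    show "AE \<zeta> in circle_measure. cnj \<zeta> powi k * rep_Linf (abs_Linf (\<lambda>\<zeta>. \<zeta> ^ j)) \<zeta> = \<zeta> ^ d"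
      using AE_rep_abs[OF b] AE_circle by eventually_elim (simp add: pow)
  qed (use m in measurable)
  also have "\<dots> = 0 ^ d"
    by (rule circle_mean_value) (intro holomorphic_intros)
  finally show ?thesis using assms by (simp add: d_def)
qed

lemma monomial_in_Hinf: "abs_Linf (\<lambda>\<zeta>. \<zeta> ^ j) \<in> Hinf"
  by (auto simp: Hinf_def fourier_coeff_monomial)

text \<open>Some nontrivial combination of the Fourier coefficients of index \<open>0\<close> and \<open>1\<close> vanishes at
  \<open>f\<close>. It is a nonzero functional on \<^const>\<open>Hinf\<close>, because its values at the first two monomials
  are its coefficients; hence its integer multiples are pairwise distinct and supply as many
  functionals as desired.\<close>

lemma annihilating_functionals:
  assumes f: "f \<in> Hinf"
  obtains \<Phi> where "\<Phi> \<subseteq> Hinf_dual" "finite \<Phi>" "card \<Phi> = N" "f \<in> Hinf_sub \<Phi>"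
proof -
  obtain a b :: complex where ab: "a * fourier_coeff f 0 + b * fourier_coeff f 1 = 0" "a \<noteq> 0 \<or> b \<noteq> 0"
  proof (cases "fourier_coeff f 0 = 0")
    case True
    then show thesis by (intro that[of 1 0]) auto
  next
    case False
    then show thesis by (intro that[of "fourier_coeff f 1" "- fourier_coeff f 0"]) auto
  qed
  define \<phi> where "\<phi> g = a * fourier_coeff g 0 + b * fourier_coeff g 1" for g
  have nz: "\<exists>g\<in>Hinf. \<phi> g \<noteq> 0"
  proof (cases "b = 0")
    case True
    have "\<phi> (abs_Linf (\<lambda>\<zeta>. \<zeta> ^ 0)) = a"
      using fourier_coeff_monomial[of 0 0] True by (simp add: \<phi>_def)
    then show ?thesis using True ab(2) by (intro bexI[OF _ monomial_in_Hinf[of 0]]) simp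
  next
    case False
    have "\<phi> (abs_Linf (\<lambda>\<zeta>. \<zeta> ^ 1)) = b"
      using fourier_coeff_monomial[of 0 1] fourier_coeff_monomial[of 1 1] by (simp add: \<phi>_def)
    then show ?thesis using False by (intro bexI[OF _ monomial_in_Hinf[of 1]]) simp
  qed
  have bound: "cmod (of_nat j * \<phi> g) \<le> (real j * (cmod a + cmod b)) * norm g" for j :: nat and g
  proof -
    have "cmod (\<phi> g) \<le> cmod a * norm g + cmod b * norm g"
      unfolding \<phi>_def
      by (intro norm_triangle_le add_mono) (auto simp: norm_mult intro!: mult_left_mono cmod_fourier_coeff_le)
    then have "real j * cmod (\<phi> g) \<le> real j * (cmod a * norm g + cmod b * norm g)"
      by (rule mult_left_mono) simp
    then show ?thesis by (simp add: norm_mult algebra_simps)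
  qed
  define \<psi> where "\<psi> j = restrict (\<lambda>g. of_nat j * \<phi> g) Hinf" for j :: nat
  have "\<exists>C. \<forall>g\<in>Hinf. cmod (\<psi> j g) \<le> C * norm g" for j
    by (intro exI[of _ "real j * (cmod a + cmod b)"] ballI) (simp only: \<psi>_def restrict_apply' bound)
  then have "\<psi> j \<in> Hinf_dual" for j
    unfolding Hinf_dual_def
    by (auto simp: \<psi>_def Hinf_add Hinf_cscale \<phi>_def fourier_coeff_add fourier_coeff_cscale algebra_simps)
  moreover have "inj_on \<psi> {..<N}"
  proof (rule inj_onI)
    fix i j assume "\<psi> i = \<psi> j"
    then show "i = j"
      using nz by (auto simp: \<psi>_def fun_eq_iff restrict_def split: if_splits)
  qed
  moreover have "f \<in> Hinf_sub (\<psi> ` {..<N})"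
    using f ab(1) by (auto simp: Hinf_sub_def \<psi>_def \<phi>_def)
  ultimately show thesis
    by (intro that[of "\<psi> ` {..<N}"]) (auto simp: card_image)
qed

lemma eps_star_le:
  assumes "0 < \<eta>" "\<eta> < 1" "\<gamma> < 1"
  shows "eps_star N \<eta> \<gamma> \<le> ereal (sqrt (1 - \<eta>\<^sup>2))"
proof -
  obtain f where f: "f \<in> Hinf" "norm f = 1" "AE \<zeta> in circle_measure. \<eta> \<le> cmod (rep_Linf f \<zeta>)"
    "\<gamma> \<le> measure circle_measure (sublevel \<eta> f)"
    by (rule two_valued_function_in_class[OF assms])
  obtain \<Phi> where \<Phi>: "\<Phi> \<subseteq> Hinf_dual" "finite \<Phi>" "card \<Phi> = N" "f \<in> Hinf_sub \<Phi>"
    by (rule annihilating_functionals[OF f(1)])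
  have "eps \<Phi> f \<le> ereal (sqrt (1 - \<eta>\<^sup>2)) + ereal e" if "0 < e" for e
  proof -
    have "0 \<le> sqrt (1 - \<eta>\<^sup>2)" using assms by (simp add: power_le_one)
    then have "0 < sqrt (1 - \<eta>\<^sup>2) + e" using that by linarith
    moreover have "admissible (Hinf_sub \<Phi>) f (sqrt (1 - \<eta>\<^sup>2) + e)"
      using that by (intro admissible_if_modulus_ge[OF assms(1,2) f(3)]) simp
    ultimately have "eps \<Phi> f \<le> ereal (sqrt (1 - \<eta>\<^sup>2) + e)"
      unfolding eps_def by (intro INF_lower) simp
    then show ?thesis by simp
  qed
  then have "eps \<Phi> f \<le> ereal (sqrt (1 - \<eta>\<^sup>2))"
    by (rule ereal_le_epsilon2)
  moreover have "f \<in> small_set_class \<Phi> \<eta> \<gamma>"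
    using f \<Phi> by (simp add: small_set_class_def)
  ultimately have "(INF f\<in>small_set_class \<Phi> \<eta> \<gamma>. eps \<Phi> f) \<le> ereal (sqrt (1 - \<eta>\<^sup>2))"
    by (rule INF_lower2[rotated])
  then show ?thesis
    unfolding eps_star_def by (rule INF_lower2[rotated]) (simp add: \<Phi>)
qed

theorem theorem1p2:
  shows "\<exists>c::real. c > 0 \<and>
    (\<forall>(\<eta>::real) (\<gamma>::real) (N::nat).
       0 < \<eta> \<and> \<eta> < 1 \<and> 0 < \<gamma> \<and> \<gamma> < 1 \<and> 0 < N \<longrightarrow>
         ereal ((c * \<gamma>) ^ N * (1 - \<eta>)) \<le> eps_star N \<eta> \<gamma> \<and>
         eps_star N \<eta> \<gamma> \<le> ereal (sqrt (1 - \<eta>\<^sup>2)))"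
proof (intro exI[of _ 1] conjI allI impI)
  fix \<eta> \<gamma> :: real and N :: nat
  assume *: "0 < \<eta> \<and> \<eta> < 1 \<and> 0 < \<gamma> \<and> \<gamma> < 1 \<and> 0 < N"
  then have "(1 * \<gamma>) ^ N * (1 - \<eta>) \<le> 1 - \<eta>"
    by (simp add: mult_left_le_one_le power_le_one)
  then have "ereal ((1 * \<gamma>) ^ N * (1 - \<eta>)) \<le> ereal (1 - \<eta>)"
    by simp
  also have "\<dots> \<le> eps_star N \<eta> \<gamma>"
    using * by (intro eps_star_ge) auto
  finally show "ereal ((1 * \<gamma>) ^ N * (1 - \<eta>)) \<le> eps_star N \<eta> \<gamma>" .
  show "eps_star N \<eta> \<gamma> \<le> ereal (sqrt (1 - \<eta>\<^sup>2))"
    using * by (intro eps_star_le) auto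
qed simp

end
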